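(* Let $\alpha \ge 1$ be any approximation factor (possibly depending on $n$). Any \textsf{CONGEST} algorithm that, on every instance of the integral Santa Claus problem, outputs an integral gift assignment whose value is at least $\mathrm{OPT}/\alpha$ requires $\widetilde{\Omega}(\sqrt{n}+D)$ rounds in the worst case, where $n$ is the number of vertices and $D$ the diameter of the communication network.
   Context: Santa Claus problem: given a set of children $\mathcal C$, a set of gifts $\mathcal G$, values $v_g \ge 0$ for $g\in\mathcal G$, and a bipartite graph $G=(\mathcal C\cup\mathcal G,E)$ where $\{c,g\}\in E$ means child $c$ desires gift $g$, an integral solution assigns to each child $c$ a set $\mathcal G_c\subseteq N(c)$, the sets being pairwise disjoint; its value is $\min_{c\in\mathcal C}\sum_{g\in\mathcal G_c} v_g$, and $\mathrm{OPT}$ is the maximum value. In the \textsf{CONGEST} model the graph $G$ ($n$ vertices, diameter $D$) is the communication network; in synchronous rounds each vertex may send an $O(\log n)$-bit message to each neighbor; at the end each child knows its gifts and each gift knows its child. $\widetilde{\Omega}$ hides polylogarithmic factors. *)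

theory Defs
  imports "HOL-Probability.Probability"
begin

section \<open>The integral Santa Claus problem\<close>

text \<open>
  Vertices are natural numbers, which double as the unique identifiers of the network nodes.
  A pair \<open>(c, g)\<close> in \<open>desires\<close> is the edge between child \<open>c\<close> and gift \<open>g\<close>.
\<close>

record santa =
  children :: "nat set"
  gifts :: "nat set"
  desires :: "(nat \<times> nat) set"
  gift_value :: "nat \<Rightarrow> real"

definition vertices :: "santa \<Rightarrow> nat set" where
  "vertices I = children I \<union> gifts I"

definition num_vertices :: "santa \<Rightarrow> nat" where
  "num_vertices I = card (vertices I)"

definition adj :: "santa \<Rightarrow> (nat \<times> nat) set" where
  "adj I = desires I \<union> (desires I)\<inverse>"

definition nbrs :: "santa \<Rightarrow> nat \<Rightarrow> nat set" where
  "nbrs I v = {u. (v, u) \<in> adj I}"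

definition graph_dist :: "santa \<Rightarrow> nat \<Rightarrow> nat \<Rightarrow> nat" where
  "graph_dist I u v = (LEAST k. (u, v) \<in> adj I ^^ k)"

definition graph_diameter :: "santa \<Rightarrow> nat" where
  "graph_diameter I = Max {graph_dist I u v | u v. u \<in> vertices I \<and> v \<in> vertices I}"

text \<open>
  The identifiers of a network on \<open>n\<close> vertices are exactly \<open>0, \<dots>, n - 1\<close>.  An algorithm that copes
  with a larger identifier space copes with this one in particular, so the restriction only makes
  a lower bound stronger.  The network is connected, and there is at least one child, as
  otherwise the value of a solution would be a minimum over the empty set.
\<close>

definition santa_instance :: "santa \<Rightarrow> bool" where
  "santa_instance I \<longleftrightarrow>
     finite (vertices I) \<and> vertices I = {..<num_vertices I} \<and>
     children I \<noteq> {} \<and> children I \<inter> gifts I = {} \<and>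
     desires I \<subseteq> children I \<times> gifts I \<and>
     (\<forall>g\<in>gifts I. 0 \<le> gift_value I g) \<and>
     (\<forall>u\<in>vertices I. \<forall>v\<in>vertices I. (u, v) \<in> (adj I)\<^sup>*)"

definition integral_assignment :: "santa \<Rightarrow> (nat \<Rightarrow> nat set) \<Rightarrow> bool" where
  "integral_assignment I \<sigma> \<longleftrightarrow>
     (\<forall>c\<in>children I. \<sigma> c \<subseteq> nbrs I c) \<and>
     (\<forall>c\<in>children I. \<forall>d\<in>children I. c \<noteq> d \<longrightarrow> \<sigma> c \<inter> \<sigma> d = {})"

definition assignment_value :: "santa \<Rightarrow> (nat \<Rightarrow> nat set) \<Rightarrow> real" where
  "assignment_value I \<sigma> = Min ((\<lambda>c. \<Sum>g\<in>\<sigma> c. gift_value I g) ` children I)"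

definition OPT :: "santa \<Rightarrow> real" where
  "OPT I = Max {assignment_value I \<sigma> | \<sigma>. integral_assignment I \<sigma>}"

section \<open>The CONGEST model\<close>

text \<open>
  What a vertex knows before the first round: the number of vertices of the network, its own
  identifier, whether it is a child, the identifiers of its neighbours, and the values of the
  gifts among itself and its neighbours (\<open>0\<close> at all other positions).
\<close>

record local_view =
  network_size :: nat
  own_id :: nat
  is_child :: bool
  neighbours :: "nat set"
  known_values :: "nat \<Rightarrow> real"

definition view :: "santa \<Rightarrow> nat \<Rightarrow> local_view" where
  "view I v =
     \<lparr>network_size = num_vertices I, own_id = v, is_child = (v \<in> children I),
      neighbours = nbrs I v,
      known_values = (\<lambda>g. if g \<in> gifts I \<inter> insert v (nbrs I v) then gift_value I g else 0)\<rparr>"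

text \<open>
  A history lists, round by round, the message received from each neighbour; the empty message
  stands for silence.  Local computation is unrestricted and a vertex may remember everything, so
  the state of a vertex is its initial view together with its history.  \<open>send\<close> gives the message
  for each neighbour in the next round.  \<open>decide\<close> is \<open>None\<close> as long as the vertex is undecided;
  a child finally outputs its set of gifts, and a gift the set of children that receive it.
\<close>

type_synonym history = "(nat \<Rightarrow> bool list) list"

record algorithm =
  send :: "local_view \<Rightarrow> history \<Rightarrow> nat \<Rightarrow> bool list"
  decide :: "local_view \<Rightarrow> history \<Rightarrow> nat set option"

text \<open>
  Messages have at most \<open>\<beta> log n\<close> bits, and outputs are irrevocable.  A vertex that has produced
  its output may still forward messages.
\<close>

definition congest_algorithm :: "real \<Rightarrow> algorithm \<Rightarrow> bool" where
  "congest_algorithm \<beta> a \<longleftrightarrow>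
     (\<forall>w h u. real (length (send a w h u)) \<le> \<beta> * log 2 (real (network_size w))) \<and>
     (\<forall>w h m S. decide a w h = Some S \<longrightarrow> decide a w (h @ [m]) = Some S)"

primrec hist :: "algorithm \<Rightarrow> santa \<Rightarrow> nat \<Rightarrow> nat \<Rightarrow> history" where
  "hist a I 0 v = []"
| "hist a I (Suc t) v =
     hist a I t v @ [\<lambda>u. if u \<in> nbrs I v then send a (view I u) (hist a I t u) v else []]"

definition output_after :: "algorithm \<Rightarrow> santa \<Rightarrow> nat \<Rightarrow> nat \<Rightarrow> nat set option" where
  "output_after a I t v = decide a (view I v) (hist a I t v)"

definition halted :: "algorithm \<Rightarrow> santa \<Rightarrow> nat \<Rightarrow> bool" where
  "halted a I t \<longleftrightarrow> (\<forall>v\<in>vertices I. output_after a I t v \<noteq> None)"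

text \<open>The number of rounds is \<open>\<infinity>\<close> if some vertex never decides.\<close>

definition rounds :: "algorithm \<Rightarrow> santa \<Rightarrow> enat" where
  "rounds a I = Inf (enat ` {t. halted a I t})"

definition solves :: "real \<Rightarrow> algorithm \<Rightarrow> santa \<Rightarrow> bool" where
  "solves \<alpha> a I \<longleftrightarrow>
     (\<exists>t \<sigma>. integral_assignment I \<sigma> \<and> assignment_value I \<sigma> \<ge> OPT I / \<alpha> \<and>
        (\<forall>c\<in>children I. output_after a I t c = Some (\<sigma> c)) \<and>
        (\<forall>g\<in>gifts I. output_after a I t g = Some {c \<in> children I. g \<in> \<sigma> c}))"

section \<open>Randomized algorithms and worst-case round complexity\<close>

text \<open>
  A randomized algorithm is a deterministic one that depends on an infinite sequence of fair coin
  flips.  The sequence is visible to all vertices; private coins are the special case in which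
  the vertices read disjoint parts of it, and deterministic algorithms are the constant functions.
\<close>

type_synonym randomized_algorithm = "(nat \<Rightarrow> bool) \<Rightarrow> algorithm"

definition coins :: "(nat \<Rightarrow> bool) measure" where
  "coins = PiM UNIV (\<lambda>_. measure_pmf (bernoulli_pmf (1 / 2)))"

text \<open>
  \<open>V\<close> is the set of numbers admitted as gift values, such as all nonnegative reals or all natural
  numbers.  The measure of a non-measurable set is \<open>0\<close>, so the condition below includes
  measurability of the event of success.
\<close>

definition instances :: "real set \<Rightarrow> santa set" where
  "instances V = {I. santa_instance I \<and> gift_value I ` gifts I \<subseteq> V}"

definition approximates :: "real set \<Rightarrow> (nat \<Rightarrow> real) \<Rightarrow> randomized_algorithm \<Rightarrow> bool" where
  "approximates V \<alpha> A \<longleftrightarrow>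
     (\<forall>I\<in>instances V. measure coins {\<omega>. solves (\<alpha> (num_vertices I)) (A \<omega>) I} \<ge> 2 / 3)"

definition worst_case_rounds :: "real set \<Rightarrow> randomized_algorithm \<Rightarrow> nat \<Rightarrow> nat \<Rightarrow> enat" where
  "worst_case_rounds V A n D =
     Sup {rounds (A \<omega>) I | \<omega> I. I \<in> instances V \<and> num_vertices I = n \<and> graph_diameter I = D}"

end

theory Submission
  imports Defs
begin

text \<open>
  An algorithm whose value is at least \<open>OPT / \<alpha>\<close> must satisfy every child as soon as this is
  possible at all, so \<open>\<alpha>\<close> plays no role.  On a path \<open>g c g c \<dots> g\<close> with all gifts worth 1 except one
  of its ends, every child is forced to take the neighbouring gift on the side away from the
  worthless end.  Hence a child in the middle of a path of length \<open>D\<close> has to learn at which end the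
  worthless gift is, which takes about \<open>D / 2\<close> rounds.

  For the bound \<open>sqrt n\<close>, take about \<open>sqrt n\<close> such paths of length about \<open>sqrt n\<close>, all folded in
  the middle so that both ends are in column 0, and a binary tree whose leaves are adjacent to the
  columns.  The children at the folds output one independent bit per path.  In fewer rounds than
  there are columns they can learn these bits only through the tree.  In round \<open>t\<close> only one tree
  edge per level leads from the part within distance \<open>t\<close> of column 0, measured along the paths, to
  the part beyond distance \<open>t + 1\<close>, so \<open>T\<close> rounds transport \<open>O(T (log n)\<^sup>2)\<close> bits.  Counting
  transcripts replaces communication complexity here: outputs that are right for two thirds of the
  inputs, for one fixed outcome of the coins, need that many distinct transcripts.
\<close>

section \<open>Assignments, distances and outputs\<close>

lemma nbrs_subset_vertices:
  assumes "santa_instance I"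
  shows "nbrs I v \<subseteq> vertices I"
  using assms by (auto simp: santa_instance_def nbrs_def adj_def vertices_def)

lemma finite_assignment_values:
  assumes I: "santa_instance I"
  shows "finite {assignment_value I \<sigma> | \<sigma>. integral_assignment I \<sigma>}"
proof -
  let ?sums = "(\<lambda>S. \<Sum>g\<in>S. gift_value I g) ` Pow (vertices I)"
  have fin: "finite (vertices I)" and ne: "children I \<noteq> {}"
    using I by (auto simp: santa_instance_def)
  hence fin': "finite (children I)" by (simp add: vertices_def)
  have "{assignment_value I \<sigma> | \<sigma>. integral_assignment I \<sigma>} \<subseteq> ?sums"
  proof clarify
    fix \<sigma> assume \<sigma>: "integral_assignment I \<sigma>"
    have sub: "\<sigma> c \<subseteq> vertices I" if "c \<in> children I" for c
      using \<sigma> that nbrs_subset_vertices[OF I] by (fastforce simp: integral_assignment_def)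
    have "assignment_value I \<sigma> \<in> (\<lambda>c. \<Sum>g\<in>\<sigma> c. gift_value I g) ` children I"
      unfolding assignment_value_def using fin' ne by (intro Min_in) auto
    thus "assignment_value I \<sigma> \<in> ?sums" using sub by auto
  qed
  moreover have "finite ?sums" using fin by simp
  ultimately show ?thesis by (rule finite_subset)
qed

lemma assignment_value_le_OPT:
  assumes "santa_instance I" "integral_assignment I \<sigma>"
  shows "assignment_value I \<sigma> \<le> OPT I"
  unfolding OPT_def using finite_assignment_values[OF assms(1)] assms(2) by (intro Max_ge) auto

text \<open>The value is a minimum over the children, so the sum of each child is positive and has a
  positive term. Through this fact the approximation guarantee becomes a condition on single
  children.\<close>

lemma positive_value_gift:
  assumes I: "santa_instance I" and pos: "0 < assignment_value I \<sigma>" and c: "c \<in> children I"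
  shows "\<exists>g\<in>\<sigma> c. 0 < gift_value I g"
proof (rule ccontr)
  assume "\<not> ?thesis"
  hence "(\<Sum>g\<in>\<sigma> c. gift_value I g) \<le> 0" by (intro sum_nonpos) auto
  moreover have "assignment_value I \<sigma> \<le> (\<Sum>g\<in>\<sigma> c. gift_value I g)"
    unfolding assignment_value_def using I c
    by (intro Min_le) (auto simp: santa_instance_def vertices_def)
  ultimately show False using pos by simp
qed

text \<open>The potential \<open>\<phi>\<close> grows by at most one per edge, so it certifies that
  \<open>a\<close> and \<open>b\<close> are at distance at least \<open>D\<close>; the walks give
  the other inequality.\<close>

lemma graph_diameter_eqI:
  fixes \<phi> :: "nat \<Rightarrow> int"
  assumes fin: "finite (vertices I)"
    and walks: "\<And>u v. u \<in> vertices I \<Longrightarrow> v \<in> vertices I \<Longrightarrow> \<exists>k\<le>D. (u, v) \<in> adj I ^^ k"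
    and lip: "\<And>u v. (u, v) \<in> adj I \<Longrightarrow> \<phi> v \<le> \<phi> u + 1"
    and far: "a \<in> vertices I" "b \<in> vertices I" "\<phi> b = \<phi> a + int D"
  shows "graph_diameter I = D"
proof -
  let ?S = "{graph_dist I u v | u v. u \<in> vertices I \<and> v \<in> vertices I}"
  have le: "graph_dist I u v \<le> D" if "u \<in> vertices I" "v \<in> vertices I" for u v
    using walks[OF that] unfolding graph_dist_def by (meson Least_le order_trans)
  have lip_walk: "\<phi> v \<le> \<phi> u + int k" if "(u, v) \<in> adj I ^^ k" for u v k
    using that
  proof (induction k arbitrary: v)
    case (Suc k)
    then obtain w where w: "(u, w) \<in> adj I ^^ k" "(w, v) \<in> adj I" by auto
    show ?case using Suc.IH[OF w(1)] lip[OF w(2)] by simp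
  qed simp
  obtain k where "(a, b) \<in> adj I ^^ k" using walks[OF far(1,2)] by blast
  hence "(a, b) \<in> adj I ^^ graph_dist I a b" unfolding graph_dist_def by (rule LeastI)
  from lip_walk[OF this] have "D \<le> graph_dist I a b" using far(3) by simp
  hence "graph_dist I a b = D" using le[OF far(1,2)] by simp
  hence mem: "D \<in> ?S" using far(1,2) by blast
  have "?S \<subseteq> {..D}" using le by auto
  hence "finite ?S" using finite_subset by blast
  with mem le show ?thesis unfolding graph_diameter_def by (intro Max_eqI) auto
qed

lemma output_after_mono:
  assumes "congest_algorithm \<beta> a" "output_after a I t v = Some S" "t \<le> t'"
  shows "output_after a I t' v = Some S"
  using assms(3)
proof (induction t' rule: dec_induct)
  case (step m)
  thus ?case using assms(1) by (simp add: congest_algorithm_def output_after_def)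
qed (use assms(2) in simp)

lemma rounds_le_halted:
  assumes "rounds a I \<le> enat T"
  shows "\<exists>t\<le>T. halted a I t"
proof -
  have ne: "enat ` {t. halted a I t} \<noteq> {}"
    using assms unfolding rounds_def Inf_enat_def by (metis enat_ord_simps(5) infinity_ileE)
  hence "rounds a I \<in> enat ` {t. halted a I t}"
    unfolding rounds_def Inf_enat_def by (auto intro: LeastI)
  thus ?thesis using assms by auto
qed

text \<open>\<open>solves\<close> certifies the outputs at an unspecified time, possibly after
  \<open>T\<close>. All vertices have decided by \<open>T\<close> and outputs are irrevocable, so
  comparing at the later of the two times shows that the outputs at \<open>T\<close> are already
  these.\<close>

lemma solves_output:
  assumes a: "congest_algorithm \<beta> a" and s: "solves \<alpha> a I" and r: "rounds a I \<le> enat T"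
  obtains \<sigma> where "integral_assignment I \<sigma>" "assignment_value I \<sigma> \<ge> OPT I / \<alpha>"
    "\<And>c. c \<in> children I \<Longrightarrow> output_after a I T c = Some (\<sigma> c)"
proof -
  obtain t0 where t0: "t0 \<le> T" "halted a I t0" using rounds_le_halted[OF r] by blast
  obtain t \<sigma> where \<sigma>: "integral_assignment I \<sigma>" "assignment_value I \<sigma> \<ge> OPT I / \<alpha>"
    "\<forall>c\<in>children I. output_after a I t c = Some (\<sigma> c)"
    using s by (auto simp: solves_def)
  have "output_after a I T c = Some (\<sigma> c)" if c: "c \<in> children I" for c
  proof -
    obtain S where S: "output_after a I t0 c = Some S"
      using t0(2) c by (auto simp: halted_def vertices_def)
    have "output_after a I (max t t0) c = Some S"
      by (rule output_after_mono[OF a S]) simp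
    moreover have "output_after a I (max t t0) c = Some (\<sigma> c)"
      by (rule output_after_mono[OF a]) (use \<sigma>(3) c in auto)
    ultimately have "S = \<sigma> c" by simp
    with output_after_mono[OF a S t0(1)] show ?thesis by simp
  qed
  with \<sigma> that show ?thesis by blast
qed

section \<open>The simulation argument\<close>

text \<open>
  The number \<open>f v\<close> is a lower bound for the time at which \<open>v\<close> can tell \<open>I\<close> from \<open>J\<close>, as long as the
  difference is not revealed by messages over edges on which \<open>f\<close> grows by more than 1.
\<close>

lemma hist_agree:
  fixes f :: "nat \<Rightarrow> nat"
  assumes view: "\<And>v. 0 < f v \<Longrightarrow> view I v = view J v"
    and msg: "\<And>t u v. t < T \<Longrightarrow> Suc t < f v \<Longrightarrow> u \<in> nbrs I v \<Longrightarrow> f u \<le> t \<Longrightarrow>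
      send a (view I u) (hist a I t u) v = send a (view J u) (hist a J t u) v"
    and "t \<le> T" "t < f v"
  shows "hist a I t v = hist a J t v"
  using assms(3,4)
proof (induction t arbitrary: v)
  case (Suc t)
  have nb: "nbrs I v = nbrs J v"
    using view[of v] Suc.prems by (auto simp: view_def)
  have "send a (view I u) (hist a I t u) v = send a (view J u) (hist a J t u) v"
    if u: "u \<in> nbrs I v" for u
  \<comment> \<open>A sender with \<open>f u > t\<close> has equal histories by induction; a message
    from any other sender crosses an edge on which \<open>f\<close> grows by more than 1.\<close>
  proof (cases "f u \<le> t")
    case True
    thus ?thesis using msg[of t v u] Suc.prems u by simp
  next
    case False
    thus ?thesis using Suc.IH[of u] view[of u] Suc.prems by simp
  qed
  hence "(\<lambda>u. if u \<in> nbrs I v then send a (view I u) (hist a I t u) v else []) =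
         (\<lambda>u. if u \<in> nbrs J v then send a (view J u) (hist a J t u) v else [])"
    using nb by auto
  thus ?case using Suc by simp
qed simp

section \<open>Counting messages and fixing the coins\<close>

lemma card_bool_lists_le: "card {xs :: bool list. length xs \<le> m} \<le> 2 ^ Suc m"
proof -
  have "card {xs :: bool list. length xs \<le> m} = (\<Sum>i\<le>m. 2 ^ i)"
    using card_lists_length_le[of "UNIV :: bool set" m] by simp
  also have "\<dots> = 2 ^ Suc m - 1"
    using mask_eq_sum_exp_nat[of "Suc m"] by (simp add: atMost_def less_Suc_eq_le)
  finally show ?thesis by simp
qed

lemma finite_bool_lists_le: "finite {xs :: bool list. length xs \<le> m}"
  using finite_lists_length_le[of "UNIV :: bool set" m] by simp

text \<open>By linearity of expectation the mean of the count is at least \<open>q * card X\<close>,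
  so an outcome with the largest count attains this bound.\<close>

lemma (in prob_space) averaging:
  assumes fin: "finite X" and q: "0 < q"
    and P: "\<And>x. x \<in> X \<Longrightarrow> prob {\<omega>. P x \<omega>} \<ge> q"
  obtains \<omega> where "real (card {x \<in> X. P x \<omega>}) \<ge> q * real (card X)"
proof -
  define count where "count \<omega> = card {x \<in> X. P x \<omega>}" for \<omega>
  \<comment> \<open>A non-measurable event has measure 0, so the positive lower bound
    \<open>q\<close> forces measurability.\<close>
  have meas: "{\<omega>. P x \<omega>} \<in> events" if "x \<in> X" for x
    using P[OF that] q measure_notin_sets by fastforce
  have int: "integrable M (indicator {\<omega>. P x \<omega>} :: _ \<Rightarrow> real)" if "x \<in> X" for x
    using meas[OF that] by (intro integrable_real_indicator) (auto simp: emeasure_eq_measure)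
  have bound: "count \<omega> \<le> card X" for \<omega>
    unfolding count_def by (intro card_mono fin) auto
  hence "finite (range count)" by (auto intro: finite_subset[of _ "{..card X}"])
  then obtain \<omega>0 where max: "\<And>\<omega>. count \<omega> \<le> count \<omega>0"
    using Max_in[of "range count"] Max_ge[of "range count"] by fastforce
  have count: "real (count \<omega>) = (\<Sum>x\<in>X. indicator {\<omega>. P x \<omega>} \<omega>)" for \<omega>
    unfolding count_def using fin by (simp add: indicator_def sum.If_cases Int_def)
  have "q * real (card X) = (\<Sum>x\<in>X. q)" by simp
  also have "\<dots> \<le> (\<Sum>x\<in>X. prob {\<omega>. P x \<omega>})" by (intro sum_mono P)
  also have "\<dots> = (\<Sum>x\<in>X. expectation (indicator {\<omega>. P x \<omega>}))"
    using meas sets.sets_into_space by (intro sum.cong) (auto simp: Int_absorb2)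
  also have "\<dots> = expectation (\<lambda>\<omega>. real (count \<omega>))"
    unfolding count using int by (subst Bochner_Integration.integral_sum) auto
  also have "\<dots> \<le> expectation (\<lambda>\<omega>. real (count \<omega>0))"
  proof (rule integral_mono)
    show "integrable M (\<lambda>\<omega>. real (count \<omega>))"
      unfolding count using int by (intro Bochner_Integration.integrable_sum) auto
  qed (use max in auto)
  also have "\<dots> = real (count \<omega>0)" by (simp add: prob_space)
  finally show ?thesis using that unfolding count_def by blast
qed

interpretation coins: prob_space coins
  unfolding coins_def by (intro prob_space_PiM) (simp add: measure_pmf.prob_space_axioms)

section \<open>Families of instances on a common vertex set\<close>

text \<open>An input of type \<open>'x\<close> affects edges and values only; vertices, roles and
  identifiers are common to all inputs. Vertices have a descriptive type, and \<open>name\<close>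
  translates identifiers into it.\<close>

locale santa_family =
  fixes W :: "'v set" and name :: "nat \<Rightarrow> 'v" and n :: nat and child :: "'v \<Rightarrow> bool"
    and wants :: "'x \<Rightarrow> 'v \<Rightarrow> 'v \<Rightarrow> bool" and val :: "'x \<Rightarrow> 'v \<Rightarrow> real"
  assumes name: "bij_betw name {..<n} W"
    and wants: "wants x c g \<Longrightarrow> child c \<and> \<not> child g"
    and val: "val x g \<in> {0, 1}"
begin

definition edge :: "'x \<Rightarrow> 'v \<Rightarrow> 'v \<Rightarrow> bool" where
  "edge x u v \<longleftrightarrow> wants x u v \<or> wants x v u"

definition inst :: "'x \<Rightarrow> santa" where
  "inst x = \<lparr>children = {v. v < n \<and> child (name v)}, gifts = {v. v < n \<and> \<not> child (name v)},
     desires = {(c, g). c < n \<and> g < n \<and> wants x (name c) (name g)},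
     gift_value = (\<lambda>v. val x (name v))\<rparr>"

lemma name_in: "v < n \<Longrightarrow> name v \<in> W"
  using name by (auto simp: bij_betw_def)

lemma name_eq_iff: "u < n \<Longrightarrow> v < n \<Longrightarrow> name u = name v \<longleftrightarrow> u = v"
  using name by (auto simp: bij_betw_def inj_on_def)

lemma name_ex: "a \<in> W \<Longrightarrow> \<exists>v<n. name v = a"
  using name by (auto simp: bij_betw_def)

lemma vertices_inst [simp]: "vertices (inst x) = {..<n}"
  by (auto simp: vertices_def inst_def)

lemma num_vertices_inst [simp]: "num_vertices (inst x) = n"
  by (simp add: num_vertices_def)

lemma children_inst [simp]: "children (inst x) = {v. v < n \<and> child (name v)}"
  by (simp add: inst_def)

lemma gifts_inst [simp]: "gifts (inst x) = {v. v < n \<and> \<not> child (name v)}"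
  by (simp add: inst_def)

lemma gift_value_inst [simp]: "gift_value (inst x) v = val x (name v)"
  by (simp add: inst_def)

lemma adj_inst [simp]: "(u, v) \<in> adj (inst x) \<longleftrightarrow> u < n \<and> v < n \<and> edge x (name u) (name v)"
  by (auto simp: adj_def inst_def edge_def)

lemma nbrs_inst: "nbrs (inst x) v = {u. u < n \<and> v < n \<and> edge x (name u) (name v)}"
  by (auto simp: nbrs_def edge_def)

lemma walk_inst:
  assumes "(a, b) \<in> {(a, b). a \<in> W \<and> b \<in> W \<and> edge x a b} ^^ k"
    and "u < n" "name u = a" "v < n" "name v = b"
  shows "(u, v) \<in> adj (inst x) ^^ k"
  using assms
proof (induction k arbitrary: v b)
  case 0
  thus ?case using name_eq_iff by auto
next
  case (Suc k)
  then obtain c where c: "(a, c) \<in> {(a, b). a \<in> W \<and> b \<in> W \<and> edge x a b} ^^ k"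
    "c \<in> W" "edge x c b" by auto
  obtain w where w: "w < n" "name w = c" using name_ex[OF c(2)] by blast
  have "(u, w) \<in> adj (inst x) ^^ k" using Suc.IH[OF c(1) Suc.prems(2,3) w] .
  moreover have "(w, v) \<in> adj (inst x)" using w c(3) Suc.prems by simp
  ultimately show ?case by auto
qed

lemma santa_instance_inst:
  assumes c: "\<exists>c\<in>W. child c"
    and walks: "\<And>u v. u < n \<Longrightarrow> v < n \<Longrightarrow> \<exists>k. (u, v) \<in> adj (inst x) ^^ k"
  shows "santa_instance (inst x)"
  unfolding santa_instance_def
proof (intro conjI ballI)
  show "children (inst x) \<noteq> {}" using c name_ex by force
  show "desires (inst x) \<subseteq> children (inst x) \<times> gifts (inst x)"
    using wants by (auto simp: inst_def)
  show "0 \<le> gift_value (inst x) g" for g using val[of x "name g"] by auto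
  show "(u, v) \<in> (adj (inst x))\<^sup>*" if "u \<in> vertices (inst x)" "v \<in> vertices (inst x)" for u v
    using walks that by (simp add: rtrancl_power)
qed auto

text \<open>The matching \<open>\<mu>\<close> gives each child a single gift of value 1, so the
  optimum is at least 1.\<close>

lemma OPT_inst_pos:
  assumes I: "santa_instance (inst x)"
    and inj: "inj_on \<mu> {c \<in> W. child c}"
    and \<mu>: "\<And>c. c \<in> W \<Longrightarrow> child c \<Longrightarrow> \<mu> c \<in> W \<and> wants x c (\<mu> c) \<and> val x (\<mu> c) = 1"
  shows "0 < OPT (inst x)"
proof -
  define \<sigma> where "\<sigma> v = {u. u < n \<and> name u = \<mu> (name v)}" for v
  have single: "\<exists>u. \<sigma> v = {u} \<and> u < n \<and> name u = \<mu> (name v)" if v: "v < n" "child (name v)" for v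
  proof -
    obtain u where u: "u < n" "name u = \<mu> (name v)"
      using name_ex[of "\<mu> (name v)"] \<mu>[of "name v"] name_in v by blast
    have "\<sigma> v = {u}" unfolding \<sigma>_def using u name_eq_iff[of _ u] by auto
    with u show ?thesis by blast
  qed
  have \<sigma>: "integral_assignment (inst x) \<sigma>"
    unfolding integral_assignment_def
  proof (intro conjI ballI impI)
    fix c assume c: "c \<in> children (inst x)"
    show "\<sigma> c \<subseteq> nbrs (inst x) c"
      using c \<mu>[of "name c"] name_in by (auto simp: \<sigma>_def nbrs_inst edge_def)
    fix d assume d: "d \<in> children (inst x)" and "c \<noteq> d"
    hence "\<mu> (name c) \<noteq> \<mu> (name d)"
      using c inj_on_eq_iff[OF inj, of "name c" "name d"] name_in name_eq_iff by auto
    thus "\<sigma> c \<inter> \<sigma> d = {}" by (auto simp: \<sigma>_def)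
  qed
  have sum: "(\<Sum>g\<in>\<sigma> c. gift_value (inst x) g) = 1" if c: "c \<in> children (inst x)" for c
    using single[of c] c \<mu>[of "name c"] name_in by auto
  have ne: "children (inst x) \<noteq> {}" using I unfolding santa_instance_def by blast
  have "(\<lambda>c. \<Sum>g\<in>\<sigma> c. gift_value (inst x) g) ` children (inst x) = (\<lambda>c. 1) ` children (inst x)"
    by (intro image_cong refl sum)
  hence "assignment_value (inst x) \<sigma> = 1"
    using ne unfolding assignment_value_def by (simp add: image_constant_conv del: children_inst)
  with assignment_value_le_OPT[OF I \<sigma>] show ?thesis by simp
qed

text \<open>What an approximate solution retains once the factor is forgotten, phrased for
  descriptive vertices instead of identifiers.\<close>

definition covers :: "'x \<Rightarrow> ('v \<Rightarrow> 'v set) \<Rightarrow> bool" where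
  "covers x \<sigma> \<longleftrightarrow>
     (\<forall>c\<in>W. child c \<longrightarrow> \<sigma> c \<subseteq> {g. wants x c g} \<and> (\<exists>g\<in>\<sigma> c. 0 < val x g)) \<and>
     (\<forall>c\<in>W. \<forall>d\<in>W. child c \<longrightarrow> child d \<longrightarrow> c \<noteq> d \<longrightarrow> \<sigma> c \<inter> \<sigma> d = {})"

lemma covers_gift:
  assumes "covers x \<sigma>" "c \<in> W" "child c"
  obtains g where "g \<in> \<sigma> c" "wants x c g" "0 < val x g"
  using assms unfolding covers_def by blast

lemma covers_disjoint:
  assumes "covers x \<sigma>" "c \<in> W" "d \<in> W" "child c" "child d" "g \<in> \<sigma> c" "g \<in> \<sigma> d"
  shows "c = d"
  using assms unfolding covers_def by blast

lemma covers_of_assignment: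
  assumes I: "santa_instance (inst x)" and \<sigma>: "integral_assignment (inst x) \<sigma>"
    and pos: "0 < assignment_value (inst x) \<sigma>"
  shows "covers x (\<lambda>c. name ` \<sigma> (inv_into {..<n} name c))"
proof -
  define i where "i = inv_into {..<n} name"
  have i: "i c < n" "name (i c) = c" if "c \<in> W" for c
    using that name inv_into_into[of c name "{..<n}"]
    by (auto simp: i_def bij_betw_def f_inv_into_f)
  have sub: "\<sigma> c \<subseteq> nbrs (inst x) c" if "c < n" "child (name c)" for c
    using \<sigma> that by (auto simp: integral_assignment_def)
  have "covers x (\<lambda>c. name ` \<sigma> (i c))"
    unfolding covers_def
  proof (intro conjI ballI impI)
    fix c assume c: "c \<in> W" "child c"
    have s: "\<sigma> (i c) \<subseteq> nbrs (inst x) (i c)" using sub[of "i c"] c i by simp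
    show "name ` \<sigma> (i c) \<subseteq> {g. wants x c g}"
    proof
      fix g assume "g \<in> name ` \<sigma> (i c)"
      then obtain u where "u \<in> nbrs (inst x) (i c)" "g = name u" using s by auto
      thus "g \<in> {g. wants x c g}" using c i wants by (auto simp: nbrs_inst edge_def)
    qed
    show "\<exists>g\<in>name ` \<sigma> (i c). 0 < val x g"
      using positive_value_gift[OF I pos, of "i c"] c i by auto
    fix d assume d: "d \<in> W" "child d" "c \<noteq> d"
    have s': "\<sigma> (i d) \<subseteq> nbrs (inst x) (i d)" using sub[of "i d"] d i by simp
    have "i c \<noteq> i d" using c d i by metis
    hence "\<sigma> (i c) \<inter> \<sigma> (i d) = {}" using \<sigma> c d i by (auto simp: integral_assignment_def)
    moreover have "\<sigma> (i c) \<subseteq> {..<n}" "\<sigma> (i d) \<subseteq> {..<n}" using s s' by (auto simp: nbrs_inst)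
    ultimately show "name ` \<sigma> (i c) \<inter> name ` \<sigma> (i d) = {}"
      using name_eq_iff by (fastforce simp: subset_iff)
  qed
  thus ?thesis by (simp add: i_def)
qed

lemma view_inst_eqI:
  assumes v: "v < n"
    and e: "\<And>u. u \<in> W \<Longrightarrow> edge x u (name v) \<longleftrightarrow> edge y u (name v)"
    and val: "\<And>u. u \<in> W \<Longrightarrow> u = name v \<or> edge x u (name v) \<Longrightarrow> val x u = val y u"
  shows "view (inst x) v = view (inst y) v"
proof -
  have nb: "nbrs (inst x) v = nbrs (inst y) v"
    using e name_in by (auto simp: nbrs_inst)
  have "val x (name g) = val y (name g)" if "g = v \<or> g \<in> nbrs (inst x) v" for g
    using that val[of "name g"] v name_in by (auto simp: nbrs_inst)
  thus ?thesis using nb by (auto simp: view_def)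
qed

text \<open>
  Vertices with \<open>f v > t\<close> know nothing about \<open>x\<close> after \<open>t\<close> rounds except what they learned over the
  edges in \<open>B 0, \<dots>, B (t - 1)\<close>.  For some outcome of the coins the algorithm succeeds on two
  thirds of the inputs, and on these the messages over the edges in \<open>B\<close> determine the outputs far
  away from the input, and hence the input itself.
\<close>

lemma transcripts_bound:
  assumes fin: "finite X"
    and inst: "\<And>x. x \<in> X \<Longrightarrow> santa_instance (inst x) \<and> graph_diameter (inst x) = D"
    and opt: "\<And>x. x \<in> X \<Longrightarrow> 0 < OPT (inst x)"
    and V: "{0, 1} \<subseteq> V" and \<alpha>: "\<And>m. 1 \<le> \<alpha> m"
    and alg: "\<And>\<omega>. congest_algorithm \<beta> (A \<omega>)" and approx: "approximates V \<alpha> A"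
    and T: "worst_case_rounds V A n D \<le> enat T"
    and enter: "\<And>x t u v. x \<in> X \<Longrightarrow> u \<in> W \<Longrightarrow> v \<in> W \<Longrightarrow> edge x u v \<Longrightarrow>
      f u \<le> t \<Longrightarrow> Suc t < f v \<Longrightarrow> (u, v) \<in> B t"
    and B: "\<And>t. finite (B t) \<and> card (B t) \<le> b"
    and loc_edge: "\<And>x y u v. x \<in> X \<Longrightarrow> y \<in> X \<Longrightarrow> u \<in> W \<Longrightarrow> v \<in> W \<Longrightarrow> 0 < f v \<Longrightarrow>
      edge x u v \<longleftrightarrow> edge y u v"
    and loc_val: "\<And>x y u v. x \<in> X \<Longrightarrow> y \<in> X \<Longrightarrow> u \<in> W \<Longrightarrow> v \<in> W \<Longrightarrow> 0 < f v \<Longrightarrow>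
      u = v \<or> edge x u v \<Longrightarrow> val x u = val y u"
    and decode: "\<And>x y \<sigma> \<tau>. x \<in> X \<Longrightarrow> y \<in> X \<Longrightarrow> covers x \<sigma> \<Longrightarrow> covers y \<tau> \<Longrightarrow>
      (\<And>v. v \<in> W \<Longrightarrow> child v \<Longrightarrow> T < f v \<Longrightarrow> \<sigma> v = \<tau> v) \<Longrightarrow> x = y"
  shows "2 / 3 * real (card X) \<le> 2 ^ (Suc (nat \<lfloor>\<beta> * log 2 (real n)\<rfloor>) * (T * b))"
proof -
  define m where "m = nat \<lfloor>\<beta> * log 2 (real n)\<rfloor>"
  have mem: "inst x \<in> instances V" if "x \<in> X" for x
  proof -
    have "gift_value (inst x) g \<in> V" for g using val[of x "name g"] V by auto
    thus ?thesis using inst[OF that] unfolding instances_def by blast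
  qed
  have "coins.prob {\<omega>. solves (\<alpha> n) (A \<omega>) (inst x)} \<ge> 2 / 3" if "x \<in> X" for x
    using approx mem[OF that] num_vertices_inst unfolding approximates_def by metis
  then obtain \<omega> where
    \<omega>: "2 / 3 * real (card X) \<le> real (card {x \<in> X. solves (\<alpha> n) (A \<omega>) (inst x)})"
    by (rule coins.averaging[OF fin, rotated]) auto
  define a where "a = A \<omega>"
  have a: "congest_algorithm \<beta> a" unfolding a_def by (rule alg)
  define S where "S = {x \<in> X. solves (\<alpha> n) a (inst x)}"
  have rounds: "rounds a (inst x) \<le> enat T" if "x \<in> X" for x
  proof -
    have "rounds a (inst x) \<le> worst_case_rounds V A n D"
      unfolding worst_case_rounds_def a_def using mem[OF that] inst[OF that] num_vertices_inst
      by (intro Sup_upper) blast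
    with T show ?thesis by simp
  qed
  define E where "E s = {(u, v). u < n \<and> v < n \<and> (name u, name v) \<in> B s}" for s
  have E: "finite (E s) \<and> card (E s) \<le> b" for s
  proof -
    have inj: "inj_on (map_prod name name) (E s)"
      using name_eq_iff by (auto simp: inj_on_def E_def)
    have "map_prod name name ` E s \<subseteq> B s" by (auto simp: E_def)
    hence "finite (E s) \<and> card (E s) \<le> card (B s)"
      using B inj by (meson card_inj_on_le finite_imageD finite_subset)
    thus ?thesis using B[of s] by linarith
  qed
  define Q where "Q = (SIGMA s:{..<T}. E s)"
  have "finite Q" unfolding Q_def using E by auto
  have "card Q = (\<Sum>s<T. card (E s))" unfolding Q_def using E by (simp add: card_SigmaI)
  also have "\<dots> \<le> (\<Sum>s<T. b)" using E by (intro sum_mono) auto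
  finally have cardQ: "card Q \<le> T * b" by simp
  define M where "M = {xs :: bool list. length xs \<le> m}"
  \<comment> \<open>The transcript of an input: the messages over the edges in \<open>B s\<close> in
    the rounds \<open>s < T\<close>. It has at most \<open>T * b\<close> slots with at most
    \<open>2 ^ Suc m\<close> possible messages each.\<close>
  define tr where "tr x = (\<lambda>p\<in>Q. case p of (s, u, v) \<Rightarrow>
    send a (view (inst x) u) (hist a (inst x) s u) v)" for x
  have "length (send a w h u) \<le> m" if "network_size w = n" for w h u
    using a that le_nat_floor unfolding congest_algorithm_def m_def by blast
  hence tr: "tr ` S \<subseteq> Q \<rightarrow>\<^sub>E M"
    by (auto simp: tr_def M_def view_def)
  \<comment> \<open>Numbers that are not identifiers get 0, so \<open>0 < F v\<close> implies that
    \<open>v\<close> is a vertex.\<close>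
  define F where "F v = (if v < n then f (name v) else 0)" for v
  \<comment> \<open>Equal transcripts give equal histories wherever \<open>F v > T\<close>, hence
    equal outputs there, and \<open>decode\<close> identifies the inputs.\<close>
  have inj: "inj_on tr S"
  proof (rule inj_onI)
    fix x y assume xy: "x \<in> S" "y \<in> S" "tr x = tr y"
    hence X: "x \<in> X" "y \<in> X" by (auto simp: S_def)
    have view: "view (inst x) v = view (inst y) v" if "0 < F v" for v
    proof (rule view_inst_eqI)
      have v: "v < n" "name v \<in> W" "0 < f (name v)"
        using that name_in by (auto simp: F_def split: if_splits)
      show "v < n" by fact
      show "edge x u (name v) \<longleftrightarrow> edge y u (name v)" if "u \<in> W" for u
        using loc_edge[OF X that v(2,3)] .
      show "val x u = val y u" if "u \<in> W" "u = name v \<or> edge x u (name v)" for u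
        using loc_val[OF X that(1) v(2,3) that(2)] .
    qed
    have msg: "send a (view (inst x) u) (hist a (inst x) t u) v =
        send a (view (inst y) u) (hist a (inst y) t u) v"
      if "t < T" "Suc t < F v" "u \<in> nbrs (inst x) v" "F u \<le> t" for t u v
    proof -
      have "(t, u, v) \<in> Q"
        using that enter[OF X(1), of "name u" "name v" t] name_in
        by (auto simp: Q_def E_def F_def nbrs_inst split: if_splits)
      with fun_cong[OF xy(3), of "(t, u, v)"] show ?thesis by (simp add: tr_def)
    qed
    have hist: "hist a (inst x) T v = hist a (inst y) T v" if "T < F v" for v
      using hist_agree[of F "inst x" "inst y" T a T v] view msg that by blast
    have sol: "\<exists>\<sigma>. covers z (\<lambda>c. name ` \<sigma> (inv_into {..<n} name c)) \<and>
        (\<forall>c. c < n \<longrightarrow> child (name c) \<longrightarrow> output_after a (inst z) T c = Some (\<sigma> c))"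
      if z: "z \<in> S" for z
    proof -
      have z': "z \<in> X" "solves (\<alpha> n) a (inst z)" using z by (auto simp: S_def)
      obtain \<sigma> where \<sigma>: "integral_assignment (inst z) \<sigma>"
        "assignment_value (inst z) \<sigma> \<ge> OPT (inst z) / \<alpha> n"
        "\<And>c. c \<in> children (inst z) \<Longrightarrow> output_after a (inst z) T c = Some (\<sigma> c)"
        using solves_output[OF a z'(2) rounds[OF z'(1)]] by blast
      \<comment> \<open>A positive optimum forces a positive value, however large the factor
        is.\<close>
      have "0 < OPT (inst z) / \<alpha> n" using opt[OF z'(1)] \<alpha>[of n] by simp
      hence "0 < assignment_value (inst z) \<sigma>" using \<sigma>(2) by linarith
      with covers_of_assignment[OF _ \<sigma>(1)] inst[OF z'(1)] \<sigma>(3) show ?thesis by auto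
    qed
    obtain \<sigma> where \<sigma>: "covers x (\<lambda>c. name ` \<sigma> (inv_into {..<n} name c))"
      "\<forall>c. c < n \<longrightarrow> child (name c) \<longrightarrow> output_after a (inst x) T c = Some (\<sigma> c)"
      using sol[OF xy(1)] by blast
    obtain \<tau> where \<tau>: "covers y (\<lambda>c. name ` \<tau> (inv_into {..<n} name c))"
      "\<forall>c. c < n \<longrightarrow> child (name c) \<longrightarrow> output_after a (inst y) T c = Some (\<tau> c)"
      using sol[OF xy(2)] by blast
    show "x = y"
    proof (rule decode[OF X \<sigma>(1) \<tau>(1)])
      fix w assume w: "w \<in> W" "child w" "T < f w"
      define v where "v = inv_into {..<n} name w"
      have v: "v < n" "name v = w"
        using w(1) name inv_into_into[of w name "{..<n}"]
        by (auto simp: v_def bij_betw_def f_inv_into_f)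
      have "T < F v" using v w by (simp add: F_def)
      hence "output_after a (inst x) T v = output_after a (inst y) T v"
        using hist view unfolding output_after_def by simp
      hence "\<sigma> v = \<tau> v" using \<sigma>(2) \<tau>(2) v w by simp
      thus "name ` \<sigma> (inv_into {..<n} name w) = name ` \<tau> (inv_into {..<n} name w)"
        by (simp add: v_def)
    qed
  qed
  have M: "finite M" "card M \<le> 2 ^ Suc m"
    unfolding M_def by (rule finite_bool_lists_le card_bool_lists_le)+
  have "[] \<in> M" by (simp add: M_def)
  have "finite (Q \<rightarrow>\<^sub>E M)" using \<open>finite Q\<close> M(1) by (intro finite_PiE) auto
  hence "card S \<le> card (Q \<rightarrow>\<^sub>E M)" using inj tr by (rule card_inj_on_le[rotated 2])
  also have "\<dots> = card M ^ card Q" using \<open>finite Q\<close> by (rule card_funcsetE)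
  also have "\<dots> \<le> (2 ^ Suc m) ^ card Q" using M(2) by (intro power_mono) auto
  also have "\<dots> \<le> (2 ^ Suc m) ^ (T * b)" using cardQ by (intro power_increasing) auto
  also have "\<dots> = 2 ^ (Suc m * (T * b))" by (rule power_mult[symmetric])
  finally have "real (card S) \<le> 2 ^ (Suc m * (T * b))"
    by (metis of_nat_le_iff of_nat_numeral of_nat_power)
  with \<omega> show ?thesis unfolding S_def a_def m_def by linarith
qed

end

section \<open>Paths\<close>

text \<open>
  The vertices \<open>1, \<dots>, L\<close> (with \<open>L\<close> odd) form a path from gift to gift, and child 0 is attached to
  the end 1 or to the end \<open>L\<close>, depending on the input \<open>x\<close>; so all gifts on the path are needed, and
  the direction of the matching depends on \<open>x\<close>.  Moving a child instead of changing a value makes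
  the bound work even if the whole graph is a path with as many children as gifts.  The remaining
  vertices \<open>j > L\<close> are worthless gifts.  They lie beyond child 0 if \<open>e\<close> holds, which makes the
  diameter \<open>L + 1\<close>, and otherwise beside gift 3.
\<close>

definition path_pos :: "nat \<Rightarrow> bool \<Rightarrow> bool \<Rightarrow> nat \<Rightarrow> nat" where
  "path_pos L e x j =
     (if L < j then (if e then (if x then Suc L else 0) else (if x then 2 else 3))
      else if x then (if j = 0 then L else j - 1) else if e then Suc j else j)"

definition path_child :: "nat \<Rightarrow> nat \<Rightarrow> bool" where
  "path_child L j \<longleftrightarrow> j \<le> L \<and> even j"

definition path_edge :: "nat \<Rightarrow> bool \<Rightarrow> bool \<Rightarrow> nat \<Rightarrow> nat \<Rightarrow> bool" where
  "path_edge L e x i j \<longleftrightarrow>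
     path_pos L e x i = Suc (path_pos L e x j) \<or> path_pos L e x j = Suc (path_pos L e x i)"

definition path_wants :: "nat \<Rightarrow> bool \<Rightarrow> bool \<Rightarrow> nat \<Rightarrow> nat \<Rightarrow> bool" where
  "path_wants L e x c g \<longleftrightarrow> path_child L c \<and> \<not> path_child L g \<and> path_edge L e x c g"

definition path_val :: "nat \<Rightarrow> bool \<Rightarrow> nat \<Rightarrow> real" where
  "path_val L x g = (if g \<le> L then 1 else 0)"

text \<open>Children occupy the positions of one parity; the shift by one when \<open>x\<close> or
  \<open>e\<close> holds decides which.\<close>

lemma path_child_iff:
  assumes "odd L"
  shows "path_child L j \<longleftrightarrow> (odd (path_pos L e x j) \<longleftrightarrow> x \<or> e)"
  using assms by (auto simp: path_child_def path_pos_def)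

lemma path_edge_child:
  assumes "odd L" "path_edge L e x i j"
  shows "path_child L i \<longleftrightarrow> \<not> path_child L j"
  using assms(2) unfolding path_child_iff[OF assms(1), of _ e x] path_edge_def
  by (cases x; cases e; elim disjE; simp)

text \<open>The bounds avoid the attachment points 1 and \<open>L\<close> of child 0 and the
  children 2 and 4 next to the additional gifts, so the neighbours do not depend on the
  input.\<close>

lemma path_edge_inner:
  assumes "5 < v" "v < L"
  shows "path_edge L e x u v \<longleftrightarrow> u = v - 1 \<or> u = Suc v"
  using assms by (cases x; cases e) (auto simp: path_edge_def path_pos_def)

lemma path_pos_surj:
  assumes "p \<le> (if e then Suc L else L)" "(if e then Suc L else L) < n"
  shows "\<exists>j<n. path_pos L e x j = p"
proof -
  let ?j = "if x then (if p < L then Suc p else if p = L then 0 else Suc L)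
            else if e then (if p = 0 then Suc L else p - 1) else p"
  have "?j < n \<and> path_pos L e x ?j = p"
    using assms by (auto simp: path_pos_def split: if_splits)
  thus ?thesis by blast
qed

lemma path_pos_le: "3 \<le> L \<Longrightarrow> path_pos L e x j \<le> (if e then Suc L else L)"
  by (auto simp: path_pos_def)

lemma path_family:
  assumes "odd L"
  shows "santa_family {..<n} (\<lambda>v. v) n (path_child L) (path_wants L e) (path_val L)"
  by unfold_locales (auto simp: path_wants_def path_val_def bij_betw_def)

text \<open>Child 0 sits before gift 1, its only gift of positive value. Going on from there, each
  child finds the gift on its left taken by its predecessor.\<close>

lemma path_forced_right:
  assumes cov: "santa_family.covers {..<n} (path_child L) (path_wants L e) (path_val L) False \<sigma>"
    and L: "odd L" "L < n" and c: "path_child L c"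
  shows "Suc c \<in> \<sigma> c"
proof -
  interpret santa_family "{..<n}" "\<lambda>v. v" n "path_child L" "path_wants L e" "path_val L"
    by (rule path_family[OF L(1)])
  from c show ?thesis
  proof (induction c rule: less_induct)
    case (less c)
    hence c: "c < n" "even c" "c < L" using L by (auto simp: path_child_def le_less)
    then obtain g where g: "g \<in> \<sigma> c" "path_wants L e False c g" "0 < path_val L False g"
      using covers_gift[OF cov _ less.prems] by auto
    have "g \<le> L" using g(3) by (simp add: path_val_def split: if_splits)
    show ?case
    proof (cases "g = Suc c")
      case False
      hence "c = Suc g" using g \<open>g \<le> L\<close> c
        by (auto simp: path_wants_def path_edge_def path_pos_def split: if_splits)
      hence pr: "path_child L (c - 2)" "c - 2 < c" "g = Suc (c - 2)"
        using c by (auto simp: path_child_def elim!: oddE)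
      have "g \<in> \<sigma> (c - 2)" using less.IH[OF pr(2,1)] pr(3) by simp
      hence False
        using covers_disjoint[OF cov, of c "c - 2" g] g(1) pr(1,2) c(1) less.prems by auto
      thus ?thesis ..
    qed (use g in simp)
  qed
qed

text \<open>Now child 0 sits beyond gift \<open>L\<close> and has to take it, which pushes all other
  children towards gift 1. The induction is on the distance \<open>L - p c\<close> from child
  0.\<close>

lemma path_forced_left:
  assumes cov: "santa_family.covers {..<n} (path_child L) (path_wants L e) (path_val L) True \<sigma>"
    and L: "odd L" "L < n" and c: "path_child L c"
  shows "(if c = 0 then L else c - 1) \<in> \<sigma> c"
proof -
  interpret santa_family "{..<n}" "\<lambda>v. v" n "path_child L" "path_wants L e" "path_val L"
    by (rule path_family[OF L(1)])
  define p where "p = path_pos L e True"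
  from c show ?thesis
  proof (induction "L - p c" arbitrary: c rule: less_induct)
    case less
    hence c: "c < n" "even c" "c < L" using L by (auto simp: path_child_def le_less)
    then obtain g where g: "g \<in> \<sigma> c" "path_wants L e True c g" "0 < path_val L True g"
      using covers_gift[OF cov _ less.prems] by auto
    have "g \<le> L" using g(3) by (simp add: path_val_def split: if_splits)
    show ?case
    proof (cases "g = (if c = 0 then L else c - 1)")
      case False
      hence gc: "c \<noteq> 0" "g = Suc c"
        using g \<open>g \<le> L\<close> c by (auto simp: path_wants_def path_edge_def path_pos_def split: if_splits)
      \<comment> \<open>The child on the other side of \<open>g\<close>, one step closer to child 0
        or child 0 itself.\<close>
      define d where "d = (if g = L then 0 else Suc g)"
      have d: "path_child L d" "d \<noteq> c" "g = (if d = 0 then L else d - 1)" "L - p d < L - p c"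
        using gc \<open>g \<le> L\<close> c L by (auto simp: d_def path_child_def p_def path_pos_def)
      have "g \<in> \<sigma> d" using less.hyps[OF d(4,1)] d(3) by simp
      moreover have "d < n" using d(1) L by (auto simp: path_child_def)
      ultimately have False
        using covers_disjoint[OF cov, of c d g] g(1) d(1,2) c(1) less.prems by auto
      thus ?thesis ..
    qed (use g in simp)
  qed
qed

text \<open>Vertices are adjacent iff their positions differ by one, and every position is occupied,
  so a walk can pass through all positions in between. Vertices sharing a position meet in a
  neighbouring one.\<close>

lemma path_walk:
  fixes L n u v :: nat and e x :: bool
  assumes L: "odd L" "3 \<le> L" and n: "(if e then Suc L else L) < n"
    and uv: "u < n" "v < n"
  defines "I \<equiv> santa_family.inst (\<lambda>v. v) n (path_child L) (path_wants L e) (path_val L) x"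
  shows "\<exists>k\<le>(if e then Suc L else L). (u, v) \<in> adj I ^^ k"
proof -
  interpret santa_family "{..<n}" "\<lambda>v. v" n "path_child L" "path_wants L e" "path_val L"
    by (rule path_family[OF L(1)])
  define p where "p = path_pos L e x"
  define D where "D = (if e then Suc L else L)"
  have edge: "edge x i j \<longleftrightarrow> p i = Suc (p j) \<or> p j = Suc (p i)" for i j
    using path_edge_child[OF L(1), of e x i j]
    by (auto simp: edge_def path_wants_def path_edge_def p_def)
  have A: "(i, j) \<in> adj I \<longleftrightarrow> i < n \<and> j < n \<and> (p i = Suc (p j) \<or> p j = Suc (p i))" for i j
    by (simp add: I_def edge)
  have surj: "\<exists>j<n. p j = q" if "q \<le> D" for q
    using path_pos_surj[OF _ n] that by (simp add: D_def p_def)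
  have le: "p j \<le> D" for j
    using path_pos_le[OF L(2)] by (simp add: D_def p_def)
  \<comment> \<open>The case \<open>k = 0\<close> is excluded because several vertices may share a
    position.\<close>
  have up: "(i, j) \<in> adj I ^^ k" if "i < n" "j < n" "p j = p i + k" "0 < k" for i j k
    using that
  proof (induction k arbitrary: j)
    case (Suc k)
    show ?case
    proof (cases "k = 0")
      case True
      thus ?thesis using Suc.prems A by simp
    next
      case False
      obtain w where w: "w < n" "p w = p i + k" using surj[of "p i + k"] le[of j] Suc.prems by auto
      have "(i, w) \<in> adj I ^^ k" using Suc.IH[OF Suc.prems(1) w] False by simp
      moreover have "(w, j) \<in> adj I" using A w Suc.prems by simp
      ultimately show ?thesis by auto
    qed
  qed simp
  have down: "(i, j) \<in> adj I ^^ k" if "i < n" "j < n" "p i = p j + k" "0 < k" for i j k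
    using that
  proof (induction k arbitrary: i)
    case (Suc k)
    show ?case
    proof (cases "k = 0")
      case True
      thus ?thesis using Suc.prems A by simp
    next
      case False
      obtain w where w: "w < n" "p w = p j + k" using surj[of "p j + k"] le[of i] Suc.prems by auto
      have "(w, j) \<in> adj I ^^ k" using Suc.IH[OF w(1) Suc.prems(2) w(2)] False by simp
      moreover have "(i, w) \<in> adj I" using A w Suc.prems by simp
      ultimately show ?thesis by (blast intro: relpow_Suc_I2)
    qed
  qed simp
  have "\<exists>k\<le>D. (u, v) \<in> adj I ^^ k"
  proof (cases "p u" "p v" rule: linorder_cases)
    case less
    thus ?thesis using up[OF uv, of "p v - p u"] le[of v] by (intro exI[of _ "p v - p u"]) auto
  next
    case greater
    thus ?thesis using down[OF uv, of "p u - p v"] le[of u] by (intro exI[of _ "p u - p v"]) auto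
  next
    case equal
    have "2 \<le> D" using L(2) by (simp add: D_def)
    obtain w where w: "w < n" "p w = Suc (p u) \<or> p u = Suc (p w)"
      using surj[of "Suc (p u)"] surj[of "p u - 1"] le[of u] \<open>2 \<le> D\<close>
      by (cases "p u < D") auto
    hence "(u, w) \<in> adj I" "(w, v) \<in> adj I" using A uv equal by auto
    hence "(u, v) \<in> adj I ^^ 2" by (auto simp: numeral_2_eq_2)
    thus ?thesis using \<open>2 \<le> D\<close> by blast
  qed
  thus ?thesis by (simp add: D_def)
qed

lemma path_lower_bound:
  assumes D: "15 \<le> D" "D < n"
    and V: "{0, 1} \<subseteq> V" and \<alpha>: "\<And>m. 1 \<le> \<alpha> m"
    and alg: "\<And>\<omega>. congest_algorithm \<beta> (A \<omega>)" and approx: "approximates V \<alpha> A"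
    and T: "worst_case_rounds V A n D \<le> enat T"
  shows "D \<le> 2 * T + 12"
proof (rule ccontr)
  assume far: "\<not> D \<le> 2 * T + 12"
  define e where "e = even D"
  \<comment> \<open>The number \<open>L\<close> has to be odd; for even \<open>D\<close> the
    worthless gifts beyond child 0 supply the missing step.\<close>
  define L where "L = (if e then D - 1 else D)"
  have L: "odd L" "14 \<le> L" and DL: "D = (if e then Suc L else L)"
    using D by (auto simp: L_def e_def)
  have n: "(if e then Suc L else L) < n" using D DL by simp
  interpret santa_family "{..<n}" "\<lambda>v. v" n "path_child L" "path_wants L e" "path_val L"
    by (rule path_family[OF L(1)])
  define f where "f v = (if L < v then 0 else min (v - 5) (L - v))" for v
  have edge: "edge x i j \<longleftrightarrow> path_edge L e x i j" for x i j
    using path_edge_child[OF L(1), of e x i j]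
    by (auto simp: edge_def path_wants_def path_edge_def)
  have inner: "edge x u v \<longleftrightarrow> u = v - 1 \<or> u = Suc v" if "0 < f v" for x u v
    unfolding edge using that by (intro path_edge_inner) (auto simp: f_def split: if_splits)
  have inst: "santa_instance (inst x)" for x
  proof (rule santa_instance_inst)
    show "\<exists>c\<in>{..<n}. path_child L c" using D by (intro bexI[of _ 0]) (auto simp: path_child_def)
    show "\<exists>k. (u, v) \<in> adj (inst x) ^^ k" if "u < n" "v < n" for u v
      using path_walk[OF L(1) _ n that] L(2) by fastforce
  qed
  have diam: "graph_diameter (inst x) = D" for x
  proof -
    obtain a b where ab: "a < n" "path_pos L e x a = 0" "b < n" "path_pos L e x b = D"
      using path_pos_surj[OF _ n, of 0 x] path_pos_surj[OF _ n, of D x] DL by auto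
    show ?thesis
    proof (rule graph_diameter_eqI)
      show "\<exists>k\<le>D. (u, v) \<in> adj (inst x) ^^ k"
        if "u \<in> vertices (inst x)" "v \<in> vertices (inst x)" for u v
        using path_walk[OF L(1) _ n, of u v x] that L(2) unfolding DL by simp
      show "int (path_pos L e x v) \<le> int (path_pos L e x u) + 1" if "(u, v) \<in> adj (inst x)" for u v
        using that by (auto simp: edge path_edge_def)
      show "a \<in> vertices (inst x)" "b \<in> vertices (inst x)" using ab by auto
      show "int (path_pos L e x b) = int (path_pos L e x a) + int D" using ab by simp
    qed simp
  qed
  have opt: "0 < OPT (inst x)" for x
  proof -
    define \<mu> where "\<mu> c = (if x then (if c = 0 then L else c - 1) else Suc c)" for c :: nat
    show ?thesis
    proof (rule OPT_inst_pos[OF inst])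
      show "inj_on \<mu> {c \<in> {..<n}. path_child L c}"
        using L by (auto simp: inj_on_def \<mu>_def path_child_def split: if_splits)
      show "\<mu> c \<in> {..<n} \<and> path_wants L e x c (\<mu> c) \<and> path_val L x (\<mu> c) = 1"
        if "c \<in> {..<n}" "path_child L c" for c
        using that L n le_less[of c L]
        by (auto simp: \<mu>_def path_child_def path_wants_def path_edge_def path_pos_def path_val_def
            split: if_splits)
    qed
  qed
  have decode: "x = y" if "covers x \<sigma>" "covers y \<tau>"
    "\<And>v. v \<in> {..<n} \<Longrightarrow> path_child L v \<Longrightarrow> T < f v \<Longrightarrow> \<sigma> v = \<tau> v" for x y \<sigma> \<tau>
  proof -
    \<comment> \<open>An even vertex about halfway between 5 and \<open>L\<close>, where
      \<open>f\<close> is nearly largest. The slack 12 in the claim absorbs the offset 5 and the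
      rounding.\<close>
    define v where "v = 2 * ((L + 5) div 4)"
    have v: "T < f v" "path_child L v" "path_child L (Suc (Suc v)) \<or> Suc v = L" "v < L"
      using far DL L by (auto simp: v_def f_def path_child_def split: if_splits)
    have right: "Suc v \<in> \<rho> v" if "covers False \<rho>" for \<rho>
      using path_forced_right[OF that L(1) _ v(2)] n by (auto split: if_splits)
    have left: "Suc v \<notin> \<rho> v" if c: "covers True \<rho>" for \<rho>
    proof -
      define d where "d = (if Suc v = L then 0 else Suc (Suc v))"
      have d: "path_child L d" "d \<noteq> v" "d < n"
        using v n by (auto simp: d_def path_child_def v_def split: if_splits)
      have "Suc v \<in> \<rho> d"
        using path_forced_left[OF c L(1) _ d(1)] n by (auto simp: d_def split: if_splits)
      moreover have "v < n" using v(4) n by (auto split: if_splits)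
      ultimately show ?thesis using covers_disjoint[OF c, of v d "Suc v"] d v(2) by auto
    qed
    have "\<sigma> v = \<tau> v" using that(3)[of v] v n by (auto split: if_splits)
    with right left that(1,2) show ?thesis by (cases x; cases y) auto
  qed
  \<comment> \<open>Along the path \<open>f\<close> changes by at most one near every
    \<open>v\<close> with \<open>f v > 0\<close>, so no edges need to be listed in \<open>B\<close>;
    two inputs then give \<open>4 / 3 \<le> 1\<close>.\<close>
  have "2 / 3 * real (card (UNIV :: bool set)) \<le>
      2 ^ (Suc (nat \<lfloor>\<beta> * log 2 (real n)\<rfloor>) * (T * 0))"
  proof (rule transcripts_bound[where f = f and B = "\<lambda>_. {}" and V = V and \<alpha> = \<alpha> and A = A and D = D])
    show "(u, v) \<in> {}" if "edge x u v" "f u \<le> t" "Suc t < f v" for x t u v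
    proof -
      have "u = v - 1 \<or> u = Suc v" using inner[of v x u] that by simp
      thus ?thesis using that(2,3) by (auto simp: f_def split: if_splits)
    qed
    show "edge x u v \<longleftrightarrow> edge y u v" if "0 < f v" for x y u v
      using that inner by simp
    show "path_val L x u = path_val L y u" for x y u by (simp add: path_val_def)
    show "x = y" if "covers x \<sigma>" "covers y \<tau>"
      "\<And>v. v \<in> {..<n} \<Longrightarrow> path_child L v \<Longrightarrow> T < f v \<Longrightarrow> \<sigma> v = \<tau> v" for x y \<sigma> \<tau>
      using decode that by blast
  qed (use inst diam opt V \<alpha> alg approx T in auto)
  thus False by simp
qed

section \<open>Folded paths below a tree\<close>

text \<open>
  The parameter \<open>h\<close> is the height of the tree, \<open>l\<close> the length of the tail that adjusts the
  diameter, and \<open>k\<close> the number of vertices added to adjust the size.  \<open>Tree e q\<close> is the \<open>q\<close>th tree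
  node at height \<open>e\<close>, a gift; it is joined to its parent through the child \<open>Link e q\<close>, which has a
  private gift \<open>Pend e q\<close>.  Strand \<open>r < 2 * 2 ^ h\<close> runs through
  \<open>Gift r 0, Kid r 0, Gift r 1, Kid r 1, \<dots>\<close>, and the strands \<open>2 * i\<close> and \<open>2 * i + 1\<close> meet in the
  gift \<open>Mid i\<close>.  Exactly one of them is poor, that is, starts with a worthless gift, and its last
  child has to take \<open>Mid i\<close>.
\<close>

datatype node = Tree nat nat | Link nat nat | Pend nat nat | Kid nat nat | Gift nat nat
  | Mid nat | Tail nat | Extra nat

fun grid_node :: "nat \<Rightarrow> nat \<Rightarrow> node \<Rightarrow> bool" where
  "grid_node h l (Tree e q) \<longleftrightarrow> e \<le> h \<and> q < 2 ^ (h - e)"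
| "grid_node h l (Link e q) \<longleftrightarrow> e < h \<and> q < 2 ^ (h - e)"
| "grid_node h l (Pend e q) \<longleftrightarrow> e < h \<and> q < 2 ^ (h - e)"
| "grid_node h l (Kid r j) \<longleftrightarrow> r < 2 * 2 ^ h \<and> j < 2 ^ h"
| "grid_node h l (Gift r j) \<longleftrightarrow> r < 2 * 2 ^ h \<and> j < 2 ^ h"
| "grid_node h l (Mid i) \<longleftrightarrow> i < 2 ^ h"
| "grid_node h l (Tail s) \<longleftrightarrow> 1 \<le> s \<and> s \<le> l"
| "grid_node h l (Extra i) \<longleftrightarrow> False"

definition grid_nodes :: "nat \<Rightarrow> nat \<Rightarrow> nat \<Rightarrow> node set" where
  "grid_nodes h l k = Collect (grid_node h l) \<union> Extra ` {..<k}"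

fun grid_child :: "node \<Rightarrow> bool" where
  "grid_child (Link e q) = True"
| "grid_child (Kid r j) = True"
| "grid_child (Tail s) = odd s"
| "grid_child _ = False"

definition next_gift :: "nat \<Rightarrow> nat \<Rightarrow> nat \<Rightarrow> node" where
  "next_gift h r j = (if Suc j < 2 ^ h then Gift r (Suc j) else Mid (r div 2))"

definition prev_tail :: "nat \<Rightarrow> nat \<Rightarrow> node" where
  "prev_tail h s = (if s = 1 then Tree h 0 else Tail (s - 1))"

fun grid_wants :: "nat \<Rightarrow> node \<Rightarrow> node \<Rightarrow> bool" where
  "grid_wants h (Link e q) g \<longleftrightarrow> g = Tree e q \<or> g = Tree (Suc e) (q div 2) \<or> g = Pend e q"
| "grid_wants h (Kid r j) g \<longleftrightarrow> g = Tree 0 j \<or> g = Gift r j \<or> g = next_gift h r j"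
| "grid_wants h (Tail s) g \<longleftrightarrow>
     odd s \<and> (g = prev_tail h s \<or> g = Tail (Suc s) \<or> s = 1 \<and> (\<exists>i. g = Extra i))"
| "grid_wants h _ g \<longleftrightarrow> False"

definition poor :: "nat set \<Rightarrow> nat \<Rightarrow> bool" where
  "poor x r \<longleftrightarrow> (r div 2 \<in> x \<longleftrightarrow> even r)"

text \<open>Tree gifts below the root are worthless, so that strand children gain nothing from their
  leaf. The root is worth 1 because the first tail child takes it.\<close>

fun grid_val :: "nat \<Rightarrow> nat set \<Rightarrow> node \<Rightarrow> real" where
  "grid_val h x (Tree e q) = (if e = h then 1 else 0)"
| "grid_val h x (Gift r j) = (if j = 0 \<and> poor x r then 0 else 1)"
| "grid_val h x (Extra i) = 0"
| "grid_val h x _ = 1"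

text \<open>
  The time at which information starting from column 0 reaches the vertex along the strands; for a
  tree node this is the leftmost column below it.
\<close>

fun front :: "nat \<Rightarrow> node \<Rightarrow> nat" where
  "front h (Tree e q) = q * 2 ^ e"
| "front h (Link e q) = q * 2 ^ e"
| "front h (Pend e q) = q * 2 ^ e"
| "front h (Kid r j) = j"
| "front h (Gift r j) = j"
| "front h (Mid i) = 2 ^ h"
| "front h (Tail s) = 0"
| "front h (Extra i) = 0"

text \<open>Number of steps from a grid node to the root \<open>Tree h 0\<close> along
  \<open>par\<close>.\<close>

fun depth :: "nat \<Rightarrow> node \<Rightarrow> nat" where
  "depth h (Tree e q) = 2 * (h - e)"
| "depth h (Link e q) = 2 * (h - e) - 1"
| "depth h (Pend e q) = 2 * (h - e)"
| "depth h (Kid r j) = 2 * h + 1"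
| "depth h (Gift r j) = 2 * h + 2"
| "depth h (Mid i) = 2 * h + 2"
| "depth h (Tail s) = s"
| "depth h (Extra i) = 2"

fun par :: "nat \<Rightarrow> node \<Rightarrow> node" where
  "par h (Tree e q) = Link e q"
| "par h (Link e q) = Tree (Suc e) (q div 2)"
| "par h (Pend e q) = Link e q"
| "par h (Kid r j) = Tree 0 j"
| "par h (Gift r j) = Kid r j"
| "par h (Mid i) = Kid (2 * i) (2 ^ h - 1)"
| "par h (Tail s) = prev_tail h s"
| "par h (Extra i) = Tail 1"

text \<open>A height certifying the diameter: the tail counts downwards from the root, so its end
  and a strand gift differ by \<open>l + (2 * h + 2)\<close>.\<close>

fun potential :: "nat \<Rightarrow> node \<Rightarrow> int" where
  "potential h (Tail s) = - int s"
| "potential h (Extra i) = 0"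
| "potential h v = int (depth h v)"

section \<open>Size of the grid\<close>

text \<open>The two kinds of strand vertices contribute \<open>2 * 4 ^ h\<close> each, and each tree
  part at most \<open>4 ^ h\<close> because \<open>Suc h \<le> 2 ^ h\<close>.\<close>

lemma finite_grid_node: "finite (Collect (grid_node h l))"
  and card_grid_node_le: "card (Collect (grid_node h l)) \<le> 8 * 4 ^ h + l"
proof -
  define F where "F =
    [case_prod Tree ` ({..h} \<times> {..<2 ^ h}), case_prod Link ` ({..<h} \<times> {..<2 ^ h}),
     case_prod Pend ` ({..<h} \<times> {..<2 ^ h}), case_prod Kid ` ({..<2 * 2 ^ h} \<times> {..<2 ^ h}),
     case_prod Gift ` ({..<2 * 2 ^ h} \<times> {..<2 ^ h}), Mid ` {..<2 ^ h}, Tail ` {1..l}]"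
  have small: "q < 2 ^ (h - e) \<Longrightarrow> q < 2 ^ h" for q e :: nat
    by (erule order_less_le_trans) simp
  have sub: "Collect (grid_node h l) \<subseteq> \<Union> (set F)"
  proof
    fix v assume "v \<in> Collect (grid_node h l)"
    thus "v \<in> \<Union> (set F)" by (cases v) (auto simp: F_def small image_iff)
  qed
  have fin: "finite (\<Union> (set F))" by (auto simp: F_def)
  thus "finite (Collect (grid_node h l))" using sub by (rule finite_subset[rotated])
  have "Suc h \<le> 2 ^ h" by (rule Suc_leI) (rule less_exp)
  hence h: "Suc h * 2 ^ h \<le> 4 ^ h" "(2 :: nat) ^ h \<le> 4 ^ h"
    using mult_le_mono1[of "Suc h" "2 ^ h" "2 ^ h"] power_mult_distrib[of "2 :: nat" 2 h]
    by (auto intro: power_mono)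
  have im: "card (f ` A) \<le> c" if "finite A" "card A \<le> c" for f :: "'a \<Rightarrow> node" and A c
    using card_image_le[OF that(1), of f] that(2) by simp
  have four: "(2 :: nat) ^ h * 2 ^ h = 4 ^ h" using power_mult_distrib[of "2 :: nat" 2 h] by simp
  have list: "card (\<Union> (set Fs)) \<le> sum_list (map card Fs)" if "\<forall>A\<in>set Fs. finite A"
    for Fs :: "node set list"
    using that by (induction Fs) (auto intro: order_trans[OF card_Un_le])
  have "card (\<Union> (set F)) \<le> sum_list (map card F)"
    by (rule list) (auto simp: F_def)
  also have "\<dots> \<le> 4 ^ h + (4 ^ h + (4 ^ h + (2 * 4 ^ h + (2 * 4 ^ h + (4 ^ h + l)))))"
    unfolding F_def list.map sum_list.Cons sum_list.Nil add_0_right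
    by (intro add_mono im) (use h four in \<open>auto simp: card_cartesian_product\<close>)
  finally show "card (Collect (grid_node h l)) \<le> 8 * 4 ^ h + l"
    using card_mono[OF fin sub] by simp
qed

lemma finite_grid_nodes: "finite (grid_nodes h l k)"
  by (simp add: grid_nodes_def finite_grid_node)

lemma card_grid_nodes: "card (grid_nodes h l k) = card (Collect (grid_node h l)) + k"
proof -
  have "Collect (grid_node h l) \<inter> Extra ` {..<k} = {}" by auto
  thus ?thesis
    by (simp add: grid_nodes_def finite_grid_node card_Un_disjoint card_image inj_on_def)
qed

lemma grid_wants_child: "grid_wants h c g \<Longrightarrow> grid_child c \<and> \<not> grid_child g"
  by (cases c) (auto simp: next_gift_def prev_tail_def split: if_splits)

lemma grid_family:
  assumes "bij_betw name {..<n} (grid_nodes h l k)"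
  shows "santa_family (grid_nodes h l k) name n grid_child (\<lambda>x. grid_wants h) (grid_val h)"
proof unfold_locales
  show "grid_val h x g \<in> {0, 1}" for x g by (cases g) auto
qed (use assms grid_wants_child in auto)

section \<open>Edges on which the front jumps\<close>

text \<open>From a link up to its parent the leftmost column can only decrease; along a strand a
  step advances by at most one column.\<close>

lemma front_gift_le:
  assumes "grid_wants h c g"
  shows "front h g \<le> Suc (front h c)"
proof -
  have "q div 2 * (2 * 2 ^ e) \<le> q * 2 ^ e" for q e :: nat
    using mult_le_mono1[of "q div 2 * 2" q "2 ^ e"] by (simp add: mult.assoc)
  thus ?thesis
    using assms by (cases c) (auto intro: le_SucI simp: next_gift_def prev_tail_def split: if_splits)
qed

lemma front_child_le:
  assumes "grid_wants h c g" "c \<in> grid_nodes h l k"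
  shows "front h c \<le> Suc (front h g) \<or> (\<exists>e q. c = Link e q \<and> g = Tree (Suc e) (q div 2))"
  using assms
  by (cases c) (auto simp: grid_nodes_def next_gift_def prev_tail_def split: if_splits)

lemma potential_wants:
  assumes "grid_wants h c g" "c \<in> grid_nodes h l k" "1 \<le> h"
  shows "\<bar>potential h c - potential h g\<bar> \<le> 1"
  using assms
  by (cases c) (auto simp: grid_nodes_def next_gift_def prev_tail_def of_nat_diff split: if_splits)

text \<open>The parent map describes a spanning tree with root \<open>Tree h 0\<close>;
  \<open>1 \<le> l\<close> provides \<open>Tail 1\<close>, the parent of the additional
  gifts.\<close>

lemma par_grid:
  assumes "v \<in> grid_nodes h l k" "v \<noteq> Tree h 0" "1 \<le> l"
  shows "par h v \<in> grid_nodes h l k" "grid_wants h v (par h v) \<or> grid_wants h (par h v) v"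
    "depth h v = Suc (depth h (par h v))"
proof -
  have half: "q div 2 < 2 ^ (h - Suc e)" if "e < h" "q < 2 ^ (h - e)" for q e :: nat
  proof -
    have "h - e = Suc (h - Suc e)" using that by simp
    with that(2) show ?thesis by (simp add: less_mult_imp_div_less mult.commute)
  qed
  have tree: "e < h" if "q < 2 ^ (h - e)" "e \<le> h" "e = h \<longrightarrow> q \<noteq> 0" for q e :: nat
    using that by (cases "e = h") auto
  show "par h v \<in> grid_nodes h l k" "grid_wants h v (par h v) \<or> grid_wants h (par h v) v"
    "depth h v = Suc (depth h (par h v))"
    using assms
    by (cases v; force simp: grid_nodes_def prev_tail_def next_gift_def half dest: tree)+
qed


text \<open>A jump goes down the tree into \<open>Link e q\<close>, where the parent starts at or
  before column \<open>t\<close> and \<open>q * 2 ^ e > t\<close>. So \<open>q\<close> is odd, as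
  otherwise both start in the same column, and \<open>q - 1 = t div 2 ^ e\<close>: one edge for each
  height.\<close>

lemma enter_grid:
  assumes "grid_wants h u v \<or> grid_wants h v u" "u \<in> grid_nodes h l k" "v \<in> grid_nodes h l k"
    and "front h u \<le> t" "Suc t < front h v"
  shows "(u, v) \<in> (\<lambda>e. (Tree (Suc e) (Suc (t div 2 ^ e) div 2), Link e (Suc (t div 2 ^ e)))) ` {..<h}"
proof -
  have v: "grid_wants h v u"
    using assms(1) front_gift_le[of h u v] assms(4,5) by auto
  then obtain e q where uv: "v = Link e q" "u = Tree (Suc e) (q div 2)"
    using front_child_le[OF v assms(3)] assms(4,5) by auto
  have e: "e < h" using assms(2) uv by (auto simp: grid_nodes_def)
  have t: "q div 2 * 2 * 2 ^ e \<le> t" "t < q * 2 ^ e"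
    using assms(4,5) uv by (simp_all add: mult.assoc)
  have "odd q"
  proof
    assume "even q"
    thus False using t by simp
  qed
  then obtain m where m: "q = Suc (2 * m)" by (auto elim: oddE)
  have "t div 2 ^ e = 2 * m"
  proof (rule div_nat_eqI)
    show "2 ^ e * (2 * m) \<le> t" "t < 2 ^ e * Suc (2 * m)" using t m by (simp_all add: mult.commute)
  qed
  thus ?thesis using uv m e by (intro image_eqI[of _ _ e]) auto
qed

text \<open>Only the values of the gifts \<open>Gift r 0\<close> depend on the input, and these
  gifts and their neighbours have front 0.\<close>

lemma grid_val_cong:
  assumes "0 < front h v" "u = v \<or> grid_wants h u v \<or> grid_wants h v u"
  shows "grid_val h x u = grid_val h y u"
proof -
  have "\<not> (\<exists>r. u = Gift r 0)"
    using assms by (cases v) (auto simp: next_gift_def prev_tail_def split: if_splits)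
  thus ?thesis by (cases u) auto
qed

text \<open>The first child of a poor strand finds its own gift and its leaf worthless (the leaf is
  not the root as \<open>1 \<le> h\<close>), so it takes the next gift; this passes on along the
  strand.\<close>

lemma grid_forced:
  assumes cov: "santa_family.covers (grid_nodes h l k) grid_child (\<lambda>x. grid_wants h) (grid_val h) x \<sigma>"
    and name: "bij_betw name {..<n :: nat} (grid_nodes h l k)" and h: "1 \<le> h"
    and r: "r < 2 * 2 ^ h" "poor x r" and j: "j < 2 ^ h"
  shows "next_gift h r j \<in> \<sigma> (Kid r j)"
proof -
  interpret santa_family "grid_nodes h l k" name n grid_child "\<lambda>x. grid_wants h" "grid_val h"
    by (rule grid_family[OF name])
  have kid: "Kid r j \<in> grid_nodes h l k" if "j < 2 ^ h" for j
    using that r by (simp add: grid_nodes_def)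
  from j show ?thesis
  proof (induction j)
    case 0
    obtain g where "g \<in> \<sigma> (Kid r 0)" "grid_wants h (Kid r 0) g" "0 < grid_val h x g"
      using covers_gift[OF cov kid[OF 0]] by auto
    thus ?case using h r by auto
  next
    case (Suc j)
    obtain g where g: "g \<in> \<sigma> (Kid r (Suc j))" "grid_wants h (Kid r (Suc j)) g" "0 < grid_val h x g"
      using covers_gift[OF cov kid[OF Suc.prems]] by auto
    have "Gift r (Suc j) \<in> \<sigma> (Kid r j)" using Suc by (simp add: next_gift_def)
    hence "g \<noteq> Gift r (Suc j)"
      using covers_disjoint[OF cov kid kid, of j "Suc j" g] g(1) Suc.prems by auto
    thus ?case using g h by auto
  qed
qed

section \<open>Distances in the grid\<close>

lemma grid_walk_up:
  fixes h l k :: nat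
  defines "S \<equiv> {(a, b). a \<in> grid_nodes h l k \<and> b \<in> grid_nodes h l k \<and>
    (grid_wants h a b \<or> grid_wants h b a)}"
  assumes l: "1 \<le> l" and "v \<in> grid_nodes h l k" "i \<le> depth h v"
  shows "(par h ^^ i) v \<in> grid_nodes h l k \<and> depth h ((par h ^^ i) v) + i = depth h v \<and>
    (v, (par h ^^ i) v) \<in> S ^^ i \<and> ((par h ^^ i) v, v) \<in> S ^^ i"
  using assms(4)
proof (induction i)
  case (Suc i)
  define w where "w = (par h ^^ i) v"
  have w: "w \<in> grid_nodes h l k" "depth h w + i = depth h v" "(v, w) \<in> S ^^ i" "(w, v) \<in> S ^^ i"
    using Suc by (auto simp: w_def)
  have "w \<noteq> Tree h 0" using w(2) Suc.prems by auto
  note p = par_grid[OF w(1) this l]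
  have "(w, par h w) \<in> S" "(par h w, w) \<in> S" using p w(1) by (auto simp: S_def)
  hence "(v, par h w) \<in> S ^^ Suc i" using w(3) by auto
  moreover have "(par h w, v) \<in> S ^^ Suc i"
    using \<open>(par h w, w) \<in> S\<close> w(4) by (rule relpow_Suc_I2)
  ultimately show ?case using p w(2) by (simp add: w_def[symmetric])
qed (use assms(3) in simp)

lemma par_funpow_Tail: "i < s \<Longrightarrow> (par h ^^ i) (Tail s) = Tail (s - i)"
  by (induction i) (auto simp: prev_tail_def)

lemma depth_eq_0:
  assumes "v \<in> grid_nodes h l k" "depth h v = 0"
  shows "v = Tree h 0"
  using assms by (cases v) (auto simp: grid_nodes_def)

text \<open>Two tail vertices are joined along the tail. Otherwise a walk through the root is short
  enough: one depth is at most \<open>2 * h + 2\<close> and the other at most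
  \<open>l\<close>.\<close>

lemma grid_walk:
  fixes h l k :: nat
  defines "S \<equiv> {(a, b). a \<in> grid_nodes h l k \<and> b \<in> grid_nodes h l k \<and>
    (grid_wants h a b \<or> grid_wants h b a)}"
  assumes l: "2 * h + 2 \<le> l" and a: "a \<in> grid_nodes h l k" and b: "b \<in> grid_nodes h l k"
  shows "\<exists>i\<le>l + (2 * h + 2). (a, b) \<in> S ^^ i"
proof (cases "\<exists>s t. a = Tail s \<and> b = Tail t")
  case True
  then obtain s t where st: "a = Tail s" "b = Tail t" by blast
  hence le: "1 \<le> s" "s \<le> l" "1 \<le> t" "t \<le> l" using a b by (auto simp: grid_nodes_def)
  show ?thesis
  proof (cases "s \<le> t")
    case True
    have "(par h ^^ (t - s)) b = a" using par_funpow_Tail[of "t - s" t h] st le True by simp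
    thus ?thesis using grid_walk_up[of l b h k "t - s"] b l le st unfolding S_def
      by (intro exI[of _ "t - s"]) auto
  next
    case False
    have "(par h ^^ (s - t)) a = b" using par_funpow_Tail[of "s - t" s h] st le False by simp
    thus ?thesis using grid_walk_up[of l a h k "s - t"] a l le st unfolding S_def
      by (intro exI[of _ "s - t"]) auto
  qed
next
  case False
  have root: "(v, Tree h 0) \<in> S ^^ depth h v \<and> (Tree h 0, v) \<in> S ^^ depth h v"
    if v: "v \<in> grid_nodes h l k" for v
    using grid_walk_up[of l v h k "depth h v"] depth_eq_0 v l unfolding S_def by auto
  have le: "depth h v \<le> l" "depth h v \<le> 2 * h + 2 \<or> (\<exists>s. v = Tail s)" if "v \<in> grid_nodes h l k" for v
    using that l by (cases v; auto simp: grid_nodes_def)+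
  have "depth h a + depth h b \<le> l + (2 * h + 2)"
    using le[OF a] le[OF b] False by fastforce
  moreover have "(a, b) \<in> S ^^ (depth h a + depth h b)"
    using root[OF a] root[OF b] by (auto simp: relpow_add)
  ultimately show ?thesis by blast
qed

lemma poor_inj:
  assumes "poor x r" "poor x r'" "r div 2 = r' div 2"
  shows "r = r'"
proof -
  have "even r \<longleftrightarrow> even r'" using assms by (simp add: poor_def)
  with assms(3) show ?thesis by (metis even_two_times_div_two odd_two_times_div_two_succ)
qed

lemma grid_lower_bound:
  assumes h: "1 \<le> h" and D: "4 * h + 4 \<le> D" and n: "8 * 4 ^ h + D \<le> n"
    and V: "{0, 1} \<subseteq> V" and \<alpha>: "\<And>m. 1 \<le> \<alpha> m"
    and alg: "\<And>\<omega>. congest_algorithm \<beta> (A \<omega>)" and approx: "approximates V \<alpha> A"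
    and T: "worst_case_rounds V A n D \<le> enat T" and far: "Suc T < 2 ^ h"
  shows "2 ^ h \<le> Suc (nat \<lfloor>\<beta> * log 2 (real n)\<rfloor>) * (T * h)"
proof -
  \<comment> \<open>A far pair is the end of the tail and a strand gift, at distance
    \<open>l + (2 * h + 2)\<close>; the \<open>k\<close> additional gifts bring the size to exactly
    \<open>n\<close>.\<close>
  define l where "l = D - (2 * h + 2)"
  define k where "k = n - card (Collect (grid_node h l))"
  let ?W = "grid_nodes h l k"
  have l: "2 * h + 2 \<le> l" "D = l + (2 * h + 2)" using D by (auto simp: l_def)
  have "card ?W = n"
    using card_grid_node_le[of h l] n l(2) by (simp add: card_grid_nodes k_def)
  then obtain name where name: "bij_betw name {..<n} ?W"
    using ex_bij_betw_nat_finite[OF finite_grid_nodes[of h l k]] by (auto simp: atLeast0LessThan)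
  interpret santa_family ?W name n grid_child "\<lambda>x. grid_wants h" "grid_val h"
    by (rule grid_family[OF name])
  have walk: "\<exists>i\<le>D. (u, v) \<in> adj (inst x) ^^ i" if uv: "u < n" "v < n" for u v x
  proof -
    obtain i where "i \<le> D" "(name u, name v) \<in> {(a, b). a \<in> ?W \<and> b \<in> ?W \<and> edge x a b} ^^ i"
      using grid_walk[OF l(1) name_in[OF uv(1)] name_in[OF uv(2)]] l(2) unfolding edge_def by auto
    with walk_inst[OF this(2)] uv show ?thesis by blast
  qed
  have inst: "santa_instance (inst x)" for x
  proof (rule santa_instance_inst)
    show "\<exists>c\<in>?W. grid_child c"
      by (intro bexI[of _ "Kid 0 0"]) (auto simp: grid_nodes_def)
    show "\<exists>i. (u, v) \<in> adj (inst x) ^^ i" if "u < n" "v < n" for u v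
      using walk[OF that] by blast
  qed
  have diam: "graph_diameter (inst x) = D" for x
  proof -
    obtain a where a: "a < n" "name a = Tail l" using name_ex[of "Tail l"] l by (auto simp: grid_nodes_def)
    obtain b where b: "b < n" "name b = Gift 0 0" using name_ex[of "Gift 0 0"] by (auto simp: grid_nodes_def)
    show ?thesis
    proof (rule graph_diameter_eqI)
      show "\<exists>i\<le>D. (u, v) \<in> adj (inst x) ^^ i"
        if "u \<in> vertices (inst x)" "v \<in> vertices (inst x)" for u v
        using walk that by simp
      show "potential h (name v) \<le> potential h (name u) + 1" if "(u, v) \<in> adj (inst x)" for u v
        using that name_in potential_wants[OF _ _ h, of "name u" "name v" l k]
          potential_wants[OF _ _ h, of "name v" "name u" l k]
        by (auto simp: edge_def)
      show "potential h (name b) = potential h (name a) + int D" using a b l(2) by simp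
    qed (use a b in auto)
  qed
  have opt: "0 < OPT (inst x)" for x
  proof -
    \<comment> \<open>Poor strands shift by one gift and their last child takes
      \<open>Mid i\<close>; links use private gifts, and the tail shifts towards the root, which
      works for either parity of \<open>l\<close>.\<close>
    define \<mu> where "\<mu> c = (case c of Link e q \<Rightarrow> Pend e q
      | Kid r j \<Rightarrow> if poor x r then next_gift h r j else Gift r j
      | Tail s \<Rightarrow> prev_tail h s | _ \<Rightarrow> c)" for c
    show ?thesis
    proof (rule OPT_inst_pos[OF inst])
      show "inj_on \<mu> {c \<in> ?W. grid_child c}"
      proof (rule inj_onI)
        fix c d assume "c \<in> {c \<in> ?W. grid_child c}" "d \<in> {c \<in> ?W. grid_child c}" "\<mu> c = \<mu> d"
        thus "c = d"
          by (cases c; cases d)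
            (auto simp: \<mu>_def grid_nodes_def prev_tail_def next_gift_def split: if_splits dest: poor_inj)
      qed
      show "\<mu> c \<in> ?W \<and> grid_wants h c (\<mu> c) \<and> grid_val h x (\<mu> c) = 1"
        if "c \<in> ?W" "grid_child c" for c
        using that h by (cases c) (auto simp: \<mu>_def grid_nodes_def prev_tail_def next_gift_def)
    qed
  qed
  \<comment> \<open>Whichever of the strands \<open>2 * i\<close> and \<open>2 * i + 1\<close> is
    poor sends its last child to \<open>Mid i\<close>, so the output of one child reveals the
    bit.\<close>
  have last: "i \<in> x \<longleftrightarrow> Mid i \<in> \<sigma> (Kid (2 * i) (2 ^ h - 1))"
    if cov: "covers x \<sigma>" and i: "i < 2 ^ h" for x \<sigma> i
  proof -
    have next_eq: "next_gift h (2 * i) (2 ^ h - 1) = Mid i" "next_gift h (2 * i + 1) (2 ^ h - 1) = Mid i"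
      by (simp_all add: next_gift_def)
    show ?thesis
    proof
      assume "i \<in> x"
      thus "Mid i \<in> \<sigma> (Kid (2 * i) (2 ^ h - 1))"
        using grid_forced[OF cov name h, of "2 * i" "2 ^ h - 1"] i next_eq by (simp add: poor_def)
    next
      assume \<sigma>: "Mid i \<in> \<sigma> (Kid (2 * i) (2 ^ h - 1))"
      show "i \<in> x"
      proof (rule ccontr)
        assume "i \<notin> x"
        hence "Mid i \<in> \<sigma> (Kid (2 * i + 1) (2 ^ h - 1))"
          using grid_forced[OF cov name h, of "2 * i + 1" "2 ^ h - 1"] i next_eq by (simp add: poor_def)
        with \<sigma> have "Kid (2 * i) (2 ^ h - 1) = Kid (2 * i + 1) (2 ^ h - 1)"
          using i by (intro covers_disjoint[OF cov]) (auto simp: grid_nodes_def)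
        thus False by simp
      qed
    qed
  qed
  define B where "B t =
    (\<lambda>e. (Tree (Suc e) (Suc (t div 2 ^ e) div 2), Link e (Suc (t div 2 ^ e)))) ` {..<h}" for t
  have "2 / 3 * real (card (Pow {..<2 ^ h :: nat})) \<le>
      2 ^ (Suc (nat \<lfloor>\<beta> * log 2 (real n)\<rfloor>) * (T * h))"
  proof (rule transcripts_bound[where f = "front h" and B = B and V = V and \<alpha> = \<alpha> and A = A and D = D])
    show "(u, v) \<in> B t"
      if "u \<in> ?W" "v \<in> ?W" "edge x u v" "front h u \<le> t" "Suc t < front h v" for x t u v
      using that enter_grid unfolding edge_def B_def by blast
    show "finite (B t) \<and> card (B t) \<le> h" for t
      using card_image_le[of "{..<h}"] by (simp add: B_def)
    show "grid_val h x u = grid_val h y u" if "0 < front h v" "u = v \<or> edge x u v" for x y u v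
      using grid_val_cong[OF that(1)] that(2) unfolding edge_def by blast
    show "x = y" if X: "x \<in> Pow {..<2 ^ h}" "y \<in> Pow {..<2 ^ h}" and cov: "covers x \<sigma>" "covers y \<tau>"
      and eq: "\<And>v. v \<in> ?W \<Longrightarrow> grid_child v \<Longrightarrow> T < front h v \<Longrightarrow> \<sigma> v = \<tau> v" for x y \<sigma> \<tau>
    proof -
      have "i \<in> x \<longleftrightarrow> i \<in> y" if i: "i < 2 ^ h" for i
      proof -
        have "\<sigma> (Kid (2 * i) (2 ^ h - 1)) = \<tau> (Kid (2 * i) (2 ^ h - 1))"
          using far i by (intro eq) (auto simp: grid_nodes_def)
        thus ?thesis using last[OF cov(1) i] last[OF cov(2) i] by simp
      qed
      thus ?thesis using X by blast
    qed
  qed (use inst diam opt V \<alpha> alg approx T in \<open>auto simp: edge_def\<close>)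
  hence le: "2 / 3 * 2 ^ (2 ^ h) \<le> (2 :: real) ^ (Suc (nat \<lfloor>\<beta> * log 2 (real n)\<rfloor>) * (T * h))"
    by (simp add: card_Pow)
  define E where "E = Suc (nat \<lfloor>\<beta> * log 2 (real n)\<rfloor>) * (T * h)"
  \<comment> \<open>Being right on two thirds of the inputs only costs less than one bit, as
    \<open>3 / 2 < 2\<close>.\<close>
  have "(2 :: real) ^ (2 ^ h) < 2 ^ Suc E"
  proof -
    have "(2 :: real) ^ (2 ^ h) \<le> 3 / 2 * 2 ^ E" using le by (simp add: E_def)
    also have "\<dots> < 2 * 2 ^ E" by simp
    finally show ?thesis by simp
  qed
  hence "2 ^ h < Suc E" by (simp only: power_strict_increasing_iff)
  thus ?thesis by (simp add: E_def)
qed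

section \<open>The lower bound\<close>

text \<open>This makes \<open>2 ^ h\<close> of order \<open>sqrt n\<close> while
  \<open>8 * 4 ^ h\<close> stays within half of the vertices.\<close>

lemma ex_grid_size:
  assumes "64 \<le> n"
  shows "\<exists>h\<ge>1. 16 * 4 ^ h \<le> n \<and> n < 64 * (4 :: nat) ^ h"
proof -
  have "1 \<le> n div 16" using assms by simp
  then obtain h where h: "4 ^ h \<le> n div 16" "n div 16 < 4 ^ (h + 1)"
    using ex_power_ivl1[of 4 "n div 16"] by auto
  have "h \<noteq> 0" using h(2) assms by (cases h) auto
  with h show ?thesis by (intro exI[of _ h]) auto
qed

text \<open>The path suffices if \<open>D\<close> is at least \<open>sqrt n\<close>, otherwise the
  grid does. One logarithm comes from the message length, the other from the \<open>h\<close> tree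
  edges that count in each round.\<close>

lemma worst_case_rounds_finite:
  assumes n: "64 \<le> n" and D: "24 * log 2 (real n) \<le> real D" "D < n"
    and V: "{0, 1} \<subseteq> V" and \<alpha>: "\<And>m. 1 \<le> \<alpha> m"
    and alg: "\<And>\<omega>. congest_algorithm \<beta> (A \<omega>)" and approx: "approximates V \<alpha> A"
    and T: "worst_case_rounds V A n D \<le> enat T"
  shows "(sqrt (real n) + real D) / (32 * (1 + \<bar>\<beta>\<bar>)) / log 2 (real n) ^ 2 \<le> real T"
proof -
  define lg where "lg = log 2 (real n)"
  have lg: "1 \<le> lg" using n by (simp add: lg_def le_log_iff)
  hence lg2: "1 \<le> lg ^ 2" by (simp add: one_le_power)
  have D': "24 \<le> D" using D(1) lg unfolding lg_def[symmetric] by linarith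
  have weaken: "r / (32 * (1 + \<bar>\<beta>\<bar>)) / lg ^ 2 \<le> r / 32" if "0 \<le> r" for r
  proof -
    have "32 * 1 \<le> 32 * (1 + \<bar>\<beta>\<bar>) * lg ^ 2" using lg2 by (intro mult_mono) auto
    thus ?thesis using that unfolding divide_divide_eq_left by (intro divide_left_mono) auto
  qed
  have "(sqrt (real n) + real D) / (32 * (1 + \<bar>\<beta>\<bar>)) / lg ^ 2 \<le> real T"
  proof (cases "sqrt (real n) \<le> real D")
    case True
    have "D \<le> 2 * T + 12"
      using path_lower_bound[OF _ D(2) V \<alpha> alg approx T] D' by simp
    hence "(sqrt (real n) + real D) / 32 \<le> real T" using True D' by simp
    thus ?thesis by (rule order_trans[OF weaken, rotated]) simp
  next
    case False
    obtain h where h: "1 \<le> h" "16 * 4 ^ h \<le> n" "n < 64 * 4 ^ h" using ex_grid_size[OF n] by blast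
    have "sqrt (real n) \<le> real n / 2"
    proof (rule real_le_lsqrt[THEN order_trans])
      show "real n \<le> (real n / 2) ^ 2" using n by (simp add: power2_eq_square field_simps)
    qed auto
    hence size: "8 * 4 ^ h + D \<le> n" using False h(2) by linarith
    have "sqrt (real n) < 8 * 2 ^ h"
    proof (rule real_less_lsqrt)
      have "real n < real (64 * 4 ^ h)" using h(3) by (simp only: of_nat_less_iff)
      also have "\<dots> = (8 * 2 ^ h) ^ 2"
        using power_mult_distrib[of "2 :: real" 2 h] by (simp add: power2_eq_square)
      finally show "real n < (8 * 2 ^ h) ^ 2" .
    qed simp
    hence sq: "sqrt (real n) + real D \<le> 16 * 2 ^ h" using False by linarith
    have "4 ^ h \<le> n" using h(2) by simp
    hence "(4 :: real) ^ h \<le> real n" by (metis of_nat_le_iff of_nat_numeral of_nat_power)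
    moreover have "2 * real h = log 2 (4 ^ h)"
      using log_pow_cancel[of 2 "2 * h"] by (simp add: power_mult)
    ultimately have hlg: "2 * real h \<le> lg" by (simp add: lg_def log_mono)
    hence "4 * h + 4 \<le> D" using D(1) lg unfolding lg_def[symmetric] by linarith
    note grid = grid_lower_bound[OF h(1) this size V \<alpha> alg approx T]
    show ?thesis
    proof (cases "Suc T < 2 ^ h")
      case True
      define m where "m = nat \<lfloor>\<beta> * lg\<rfloor>"
      have "real m \<le> \<bar>\<beta> * lg\<bar>" unfolding m_def by linarith
      hence m: "real (Suc m) \<le> (1 + \<bar>\<beta>\<bar>) * lg" using lg by (simp add: abs_mult algebra_simps)
      have "2 ^ h \<le> Suc m * (T * h)" using grid[OF True] by (simp add: m_def lg_def)
      hence "(2 :: real) ^ h \<le> real (Suc m * (T * h))"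
        by (metis of_nat_le_iff of_nat_numeral of_nat_power)
      also have "\<dots> = real (Suc m) * (real T * real h)" by (simp only: of_nat_mult)
      also have "\<dots> \<le> ((1 + \<bar>\<beta>\<bar>) * lg) * (real T * lg)"
        using m hlg lg by (intro mult_mono) auto
      finally have "2 ^ h \<le> real T * ((1 + \<bar>\<beta>\<bar>) * lg ^ 2)"
        by (simp add: power2_eq_square mult_ac)
      hence "sqrt (real n) + real D \<le> 32 * (real T * ((1 + \<bar>\<beta>\<bar>) * lg ^ 2))"
        using sq zero_less_power[of "2 :: real" h] by linarith
      hence "sqrt (real n) + real D \<le> real T * (32 * (1 + \<bar>\<beta>\<bar>) * lg ^ 2)"
        by (simp only: mult.assoc mult.left_commute)
      moreover have "0 < 32 * (1 + \<bar>\<beta>\<bar>) * lg ^ 2" using lg by simp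
      ultimately show ?thesis by (simp only: divide_divide_eq_left pos_divide_le_eq)
    next
      case False
      \<comment> \<open>If \<open>T\<close> is too large for the grid bound, it is already of order
        \<open>sqrt n\<close>: \<open>2 ^ h \<ge> 2\<close> and \<open>2 ^ h \<le> Suc T\<close>
        give \<open>2 ^ h \<le> 2 * T\<close>.\<close>
      have "(2 :: nat) ^ 1 \<le> 2 ^ h" using h(1) by (intro power_increasing) auto
      moreover have "real (2 ^ h) \<le> real (Suc T)" using False by (simp only: of_nat_le_iff)
      ultimately have "2 ^ h \<le> 2 * real T" using False by simp
      with sq have "(sqrt (real n) + real D) / 32 \<le> real T" by simp
      thus ?thesis by (rule order_trans[OF weaken, rotated]) simp
    qed
  qed
  thus ?thesis by (simp add: lg_def)
qed

theorem theorem1p1: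
  fixes \<beta> :: real
  shows "\<exists>c>0. \<exists>k N :: nat. \<exists>K :: real.
    \<forall>(\<alpha> :: nat \<Rightarrow> real) (V :: real set) (A :: randomized_algorithm).
      (\<forall>m. \<alpha> m \<ge> 1) \<longrightarrow> {0, 1} \<subseteq> V \<longrightarrow>
      (\<forall>\<omega>. congest_algorithm \<beta> (A \<omega>)) \<longrightarrow> approximates V \<alpha> A \<longrightarrow>
      (\<forall>n D. n \<ge> N \<and> K * log 2 (real n) \<le> real D \<and> D < n \<longrightarrow>
         ereal_of_enat (worst_case_rounds V A n D)
           \<ge> ereal (c * (sqrt (real n) + real D) / log 2 (real n) ^ k))"
proof (intro exI conjI allI impI)
  \<comment> \<open>The witnesses stay schematic until the stated goals fix them: \<open>c\<close>
    here, and below the exponent 2, \<open>N = 64\<close> and \<open>K = 24\<close>.\<close>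
  show "0 < 1 / (32 * (1 + \<bar>\<beta>\<bar>))" by simp
next
  fix \<alpha> :: "nat \<Rightarrow> real" and V :: "real set" and A :: randomized_algorithm and n D :: nat
  assume \<alpha>: "\<forall>m. \<alpha> m \<ge> 1" and V: "{0, 1} \<subseteq> V" and alg: "\<forall>\<omega>. congest_algorithm \<beta> (A \<omega>)"
    and approx: "approximates V \<alpha> A"
    and n: "n \<ge> 64 \<and> 24 * log 2 (real n) \<le> real D \<and> D < n"
  show "ereal_of_enat (worst_case_rounds V A n D)
      \<ge> ereal (1 / (32 * (1 + \<bar>\<beta>\<bar>)) * (sqrt (real n) + real D) / log 2 (real n) ^ 2)"
  proof (cases "worst_case_rounds V A n D")
    case (enat T)
    hence "worst_case_rounds V A n D \<le> enat T" by simp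
    from worst_case_rounds_finite[OF _ _ _ V _ _ approx this] n \<alpha> alg enat show ?thesis by simp
  qed simp
qed

end
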